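(* The measure $M$ can be computed in time polynomial in the dimension of the Hilbert space: there is an algorithm that, given a density matrix $\rho^{\rm AB}$ on a bipartite Hilbert space $\mathcal H^{\rm A}\otimes\mathcal H^{\rm B}$ with $\dim\mathcal H^{\rm A}=d^{\rm A}$ and $\dim\mathcal H^{\rm B}=d^{\rm B}$, computes $M(\rho^{\rm AB})$ using a total number of floating-point operations $$O\Bigl[\max\bigl((d^{\rm A})^3(d^{\rm B})^3,\ (d^{\rm A})^4d^{\rm B},\ d^{\rm A}(d^{\rm B})^4\bigr)\Bigr].$$
   Context: A density matrix is a positive semidefinite Hermitian matrix of trace one. Cost model: each arithmetic operation, comparison, floor/ceiling and logarithm of real numbers counts as one floating-point operation, and diagonalizing an $n\times n$ Hermitian matrix (obtaining its eigenvalues and an orthonormal eigenbasis) costs $O(n^3)$ floating-point operations. Definition of $M$. For $x,y\ge0$ let ${\rm nim}_y(x)$ be the nearest integer multiple of $y$ to $x$, ties rounded down: ${\rm nim}_0(x)=0$, and for $y\neq0$, ${\rm nim}_y(x)=y\lfloor x/y\rfloor$ if $x-y\lfloor x/y\rfloor\le y\lceil x/y\rceil-x$, and ${\rm nim}_y(x)=y\lceil x/y\rceil$ otherwise. Let $\eta_1,\dots,\eta_m$ be the distinct eigenvalues of $\rho^{\rm AB}$, let $d^{\eta_j}$ be the dimension of the $\eta_j$-eigenspace, and let $\tilde\rho^{\eta_j}$ be $\eta_j$ times the orthogonal projector onto the $\eta_j$-eigenspace, so $\rho^{\rm AB}=\sum_j\tilde\rho^{\eta_j}$. Let $\lambda_i^{j,{\rm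 A}}$, $i=1,\dots,d_j^{\rm A}$, be the nonzero eigenvalues, with multiplicity, of ${\rm Tr}_{\rm B}\tilde\rho^{\eta_j}$, where $d_j^{\rm A}$ is its rank (an eigenvalue $\eta_j=0$ contributes an empty sum). Define $$M^{\rm A}(\rho^{\rm AB})=-\sum_{j=1}^m\sum_{i=1}^{d_j^{\rm A}}\left|\lambda_i^{j,{\rm A}}-{\rm nim}_{\eta_j}(\lambda_i^{j,{\rm A}})\right|\log_2\frac{\lambda_i^{j,{\rm A}}}{\eta_jd^{\eta_j}}.$$ $M^{\rm B}(\rho^{\rm AB})$ is defined in the same way using the nonzero eigenvalues $\lambda_i^{j,{\rm B}}$ of ${\rm Tr}_{\rm A}\tilde\rho^{\eta_j}$. Finally $M(\rho^{\rm AB})=\frac12[M^{\rm A}(\rho^{\rm AB})+M^{\rm B}(\rho^{\rm AB})]$. *)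

theory Defs
  imports
    Complex_Main
    "HOL-Library.Landau_Symbols"
    "HOL-Computational_Algebra.Polynomial"
    "Jordan_Normal_Form.Schur_Decomposition"
    "Jordan_Normal_Form.Matrix_Kernel"
    "Jordan_Normal_Form.Jordan_Normal_Form_Uniqueness"
begin

section \<open>Density matrices and partial traces\<close>

definition hermitian_mat :: "complex mat \<Rightarrow> bool" where
  "hermitian_mat A \<longleftrightarrow> mat_adjoint A = A"

definition density_matrix :: "nat \<Rightarrow> complex mat \<Rightarrow> bool" where
  "density_matrix n \<rho> \<longleftrightarrow>
     \<rho> \<in> carrier_mat n n \<and> hermitian_mat \<rho> \<and>
     (\<forall>v \<in> carrier_vec n. 0 \<le> Re ((\<rho> *\<^sub>v v) \<bullet>c v)) \<and>
     (\<Sum>i<n. \<rho> $$ (i, i)) = 1"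

text \<open>The product basis vector \<open>|a\<rangle> \<otimes> |b\<rangle>\<close> of the bipartite space has the index
  \<open>a * dB + b\<close>, where \<open>a < dA\<close> and \<open>b < dB\<close>.\<close>

definition ptrace_B :: "nat \<Rightarrow> nat \<Rightarrow> complex mat \<Rightarrow> complex mat" where
  "ptrace_B dA dB X = mat dA dA (\<lambda>(a, a'). \<Sum>b<dB. X $$ (a * dB + b, a' * dB + b))"

definition ptrace_A :: "nat \<Rightarrow> nat \<Rightarrow> complex mat \<Rightarrow> complex mat" where
  "ptrace_A dA dB X = mat dB dB (\<lambda>(b, b'). \<Sum>a<dA. X $$ (a * dB + b, a * dB + b'))"

section \<open>The measure\<close>

definition nim :: "real \<Rightarrow> real \<Rightarrow> real" where
  "nim y x =
     (if y = 0 then 0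
      else if x - y * of_int \<lfloor>x / y\<rfloor> \<le> y * of_int \<lceil>x / y\<rceil> - x
           then y * of_int \<lfloor>x / y\<rfloor>
           else y * of_int \<lceil>x / y\<rceil>)"

definition eigenspace :: "complex mat \<Rightarrow> real \<Rightarrow> complex vec set" where
  "eigenspace A \<eta> = mat_kernel (char_matrix A (complex_of_real \<eta>))"

definition eigenspace_dim :: "complex mat \<Rightarrow> real \<Rightarrow> nat" where
  "eigenspace_dim A \<eta> = kernel_dim (char_matrix A (complex_of_real \<eta>))"

definition orth_projector :: "nat \<Rightarrow> complex vec set \<Rightarrow> complex mat" where
  "orth_projector n V =
     (THE P. P \<in> carrier_mat n n \<and> hermitian_mat P \<and> P * P = P \<and>
             (\<lambda>v. P *\<^sub>v v) ` carrier_vec n = V)"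

definition eigencomponent :: "complex mat \<Rightarrow> real \<Rightarrow> complex mat" where
  "eigencomponent \<rho> \<eta> =
     complex_of_real \<eta> \<cdot>\<^sub>m orth_projector (dim_row \<rho>) (eigenspace \<rho> \<eta>)"

text \<open>Only applied to Hermitian matrices, whose eigenvalues are real, so that \<open>Re\<close> is a
  mere type conversion.\<close>

definition nonzero_eigenvalues :: "complex mat \<Rightarrow> real multiset" where
  "nonzero_eigenvalues A = image_mset Re (filter_mset (\<lambda>z. z \<noteq> 0) (proots (char_poly A)))"

definition M_reduced :: "(complex mat \<Rightarrow> complex mat) \<Rightarrow> complex mat \<Rightarrow> real" where
  "M_reduced reduce \<rho> =
     - (\<Sum>\<eta> \<in> {\<eta>. eigenvalue \<rho> (complex_of_real \<eta>)}.
          \<Sum>l \<in># nonzero_eigenvalues (reduce (eigencomponent \<rho> \<eta>)).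
            \<bar>l - nim \<eta> l\<bar> * log 2 (l / (\<eta> * real (eigenspace_dim \<rho> \<eta>))))"

definition M_A :: "nat \<Rightarrow> nat \<Rightarrow> complex mat \<Rightarrow> real" where
  "M_A dA dB \<rho> = M_reduced (ptrace_B dA dB) \<rho>"

definition M_B :: "nat \<Rightarrow> nat \<Rightarrow> complex mat \<Rightarrow> real" where
  "M_B dA dB \<rho> = M_reduced (ptrace_A dA dB) \<rho>"

definition M_measure :: "nat \<Rightarrow> nat \<Rightarrow> complex mat \<Rightarrow> real" where
  "M_measure dA dB \<rho> = (M_A dA dB \<rho> + M_B dA dB \<rho>) / 2"

section \<open>The machine model\<close>

text \<open>
  Algorithms are programs of a while language over exact reals (a real RAM). A state consists of
  natural-number variables, used for addressing and loop control, and of two-dimensional arrays of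
  reals. Real numbers influence the control flow only through comparisons, and there is no
  conversion between reals and indices. The only real constants in a program are integers.

  Every arithmetic operation, floor, ceiling, logarithm and comparison of reals has unit cost.
  Index operations, Boolean connectives, assignments and tests, which are not floating-point
  operations, are charged one unit each as well, so the cost of a run bounds its running time and
  in particular its number of floating-point operations.

  Division by zero and logarithms of nonpositive numbers take the default values of HOL. This adds
  no power, since the values (\<open>x / 0 = 0\<close>, \<open>log 2 0 = 0\<close>, \<open>log 2 (- x) = log 2 x\<close>) can be obtained
  with a constant number of comparisons and legitimate operations.
\<close>

type_synonym vname = string

datatype iexp =
    INum nat | IVar vname
  | IAdd iexp iexp | ISub iexp iexp | IMul iexp iexp

datatype rexp =
    RNum int | RGet vname iexp iexp
  | RAdd rexp rexp | RSub rexp rexp | RMul rexp rexp | RDiv rexp rexp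
  | RFloor rexp | RCeil rexp | RLog rexp

datatype bexp =
    RLess rexp rexp | REq rexp rexp
  | ILess iexp iexp | IEq iexp iexp
  | BNot bexp | BAnd bexp bexp

text \<open>\<open>Diag n re im ev ure uim\<close> diagonalizes the \<open>n \<times> n\<close> matrix with real part \<open>re\<close> and imaginary
  part \<open>im\<close>. It stores the \<open>k\<close>-th eigenvalue in \<open>ev[k,0]\<close>, and the real and imaginary parts of a
  corresponding eigenvector in the \<open>k\<close>-th columns of \<open>ure\<close> and \<open>uim\<close>.\<close>

datatype com =
    Skip
  | ISet vname iexp
  | RSet vname iexp iexp rexp
  | Diag iexp vname vname vname vname vname
  | Seq com com
  | If bexp com com
  | While bexp com

record state =
  idx :: "vname \<Rightarrow> nat"
  arr :: "vname \<times> nat \<times> nat \<Rightarrow> real"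

primrec ival :: "iexp \<Rightarrow> state \<Rightarrow> nat" where
  "ival (INum n) s = n"
| "ival (IVar x) s = idx s x"
| "ival (IAdd a b) s = ival a s + ival b s"
| "ival (ISub a b) s = ival a s - ival b s"
| "ival (IMul a b) s = ival a s * ival b s"

primrec icost :: "iexp \<Rightarrow> nat" where
  "icost (INum n) = 0"
| "icost (IVar x) = 0"
| "icost (IAdd a b) = icost a + icost b + 1"
| "icost (ISub a b) = icost a + icost b + 1"
| "icost (IMul a b) = icost a + icost b + 1"

primrec rval :: "rexp \<Rightarrow> state \<Rightarrow> real" where
  "rval (RNum z) s = real_of_int z"
| "rval (RGet x i j) s = arr s (x, ival i s, ival j s)"
| "rval (RAdd a b) s = rval a s + rval b s"
| "rval (RSub a b) s = rval a s - rval b s"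
| "rval (RMul a b) s = rval a s * rval b s"
| "rval (RDiv a b) s = rval a s / rval b s"
| "rval (RFloor a) s = real_of_int \<lfloor>rval a s\<rfloor>"
| "rval (RCeil a) s = real_of_int \<lceil>rval a s\<rceil>"
| "rval (RLog a) s = log 2 (rval a s)"

primrec rcost :: "rexp \<Rightarrow> nat" where
  "rcost (RNum z) = 0"
| "rcost (RGet x i j) = icost i + icost j"
| "rcost (RAdd a b) = rcost a + rcost b + 1"
| "rcost (RSub a b) = rcost a + rcost b + 1"
| "rcost (RMul a b) = rcost a + rcost b + 1"
| "rcost (RDiv a b) = rcost a + rcost b + 1"
| "rcost (RFloor a) = rcost a + 1"
| "rcost (RCeil a) = rcost a + 1"
| "rcost (RLog a) = rcost a + 1"

primrec bval :: "bexp \<Rightarrow> state \<Rightarrow> bool" where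
  "bval (RLess a b) s \<longleftrightarrow> rval a s < rval b s"
| "bval (REq a b) s \<longleftrightarrow> rval a s = rval b s"
| "bval (ILess a b) s \<longleftrightarrow> ival a s < ival b s"
| "bval (IEq a b) s \<longleftrightarrow> ival a s = ival b s"
| "bval (BNot b) s \<longleftrightarrow> \<not> bval b s"
| "bval (BAnd b c) s \<longleftrightarrow> bval b s \<and> bval c s"

primrec bcost :: "bexp \<Rightarrow> nat" where
  "bcost (RLess a b) = rcost a + rcost b + 1"
| "bcost (REq a b) = rcost a + rcost b + 1"
| "bcost (ILess a b) = icost a + icost b + 1"
| "bcost (IEq a b) = icost a + icost b + 1"
| "bcost (BNot b) = bcost b + 1"
| "bcost (BAnd b c) = bcost b + bcost c + 1"

text \<open>A diagonalization routine returns, for every Hermitian matrix, the eigenvalues and a matrix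
  whose columns form an orthonormal eigenbasis. Nothing is assumed about the choice of the
  eigenbasis, the order of the eigenvalues, or the result for other matrices.\<close>

type_synonym diagonalizer = "complex mat \<Rightarrow> (nat \<Rightarrow> real) \<times> complex mat"

definition diagonalization :: "nat \<Rightarrow> complex mat \<Rightarrow> (nat \<Rightarrow> real) \<Rightarrow> complex mat \<Rightarrow> bool" where
  "diagonalization n A e U \<longleftrightarrow>
     U \<in> carrier_mat n n \<and>
     (\<forall>k<n. A *\<^sub>v col U k = complex_of_real (e k) \<cdot>\<^sub>v col U k) \<and>
     (\<forall>k<n. \<forall>l<n. col U k \<bullet>c col U l = (if k = l then 1 else 0))"

definition diagonalizes :: "diagonalizer \<Rightarrow> bool" where
  "diagonalizes diag \<longleftrightarrow>
     (\<forall>n. \<forall>A \<in> carrier_mat n n. hermitian_mat A \<longrightarrow>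
        diagonalization n A (fst (diag A)) (snd (diag A)))"

definition read_mat :: "nat \<Rightarrow> vname \<Rightarrow> vname \<Rightarrow> state \<Rightarrow> complex mat" where
  "read_mat n re im s = mat n n (\<lambda>(i, j). Complex (arr s (re, i, j)) (arr s (im, i, j)))"

definition write_diag ::
  "nat \<Rightarrow> vname \<Rightarrow> vname \<Rightarrow> vname \<Rightarrow> (nat \<Rightarrow> real) \<times> complex mat \<Rightarrow> state \<Rightarrow> state" where
  "write_diag n ev ure uim r s = s\<lparr>arr := (\<lambda>(x, i, j).
      if x = ev \<and> i < n \<and> j = 0 then fst r i
      else if x = ure \<and> i < n \<and> j < n then Re (snd r $$ (i, j))
      else if x = uim \<and> i < n \<and> j < n then Im (snd r $$ (i, j))
      else arr s (x, i, j))\<rparr>"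

text \<open>\<open>exec diag D c s k t\<close>: started in \<open>s\<close>, program \<open>c\<close> terminates in \<open>t\<close> at total cost \<open>k\<close>, where
  diagonalizations are carried out by \<open>diag\<close> and cost \<open>D n\<close> for an \<open>n \<times> n\<close> matrix.\<close>

inductive exec :: "diagonalizer \<Rightarrow> (nat \<Rightarrow> nat) \<Rightarrow> com \<Rightarrow> state \<Rightarrow> nat \<Rightarrow> state \<Rightarrow> bool"
  for diag :: diagonalizer and D :: "nat \<Rightarrow> nat"
where
  Skip: "exec diag D Skip s 0 s"
| ISet: "exec diag D (ISet x a) s (icost a + 1) (s\<lparr>idx := (idx s)(x := ival a s)\<rparr>)"
| RSet: "exec diag D (RSet x i j e) s (icost i + icost j + rcost e + 1)
           (s\<lparr>arr := (arr s)((x, ival i s, ival j s) := rval e s)\<rparr>)"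
| Diag: "exec diag D (Diag a re im ev ure uim) s (icost a + D (ival a s) + 1)
           (write_diag (ival a s) ev ure uim (diag (read_mat (ival a s) re im s)) s)"
| Seq: "\<lbrakk>exec diag D c\<^sub>1 s k\<^sub>1 s'; exec diag D c\<^sub>2 s' k\<^sub>2 t\<rbrakk>
         \<Longrightarrow> exec diag D (Seq c\<^sub>1 c\<^sub>2) s (k\<^sub>1 + k\<^sub>2) t"
| IfTrue: "\<lbrakk>bval b s; exec diag D c\<^sub>1 s k t\<rbrakk>
            \<Longrightarrow> exec diag D (If b c\<^sub>1 c\<^sub>2) s (bcost b + 1 + k) t"
| IfFalse: "\<lbrakk>\<not> bval b s; exec diag D c\<^sub>2 s k t\<rbrakk>
             \<Longrightarrow> exec diag D (If b c\<^sub>1 c\<^sub>2) s (bcost b + 1 + k) t"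
| WhileFalse: "\<not> bval b s \<Longrightarrow> exec diag D (While b c) s (bcost b + 1) s"
| WhileTrue: "\<lbrakk>bval b s; exec diag D c s k\<^sub>1 s'; exec diag D (While b c) s' k\<^sub>2 t\<rbrakk>
               \<Longrightarrow> exec diag D (While b c) s (bcost b + 1 + k\<^sub>1 + k\<^sub>2) t"

inductive_cases exec_SkipE: "exec diag D Skip s k t"
inductive_cases exec_ISetE: "exec diag D (ISet x a) s k t"
inductive_cases exec_RSetE: "exec diag D (RSet x i j e) s k t"
inductive_cases exec_DiagE: "exec diag D (Diag a re im ev ure uim) s k t"
inductive_cases exec_SeqE: "exec diag D (Seq c\<^sub>1 c\<^sub>2) s k t"
inductive_cases exec_IfE: "exec diag D (If b c\<^sub>1 c\<^sub>2) s k t"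
inductive_cases exec_WhileE: "exec diag D (While b c) s k t"

lemma exec_deterministic:
  "exec diag D c s k t \<Longrightarrow> exec diag D c s k' t' \<Longrightarrow> k' = k \<and> t' = t"
proof (induction arbitrary: k' t' rule: exec.induct)
  case (Skip s)
  then show ?case by (elim exec_SkipE) simp
next
  case (ISet x a s)
  then show ?case by (elim exec_ISetE) simp
next
  case (RSet x i j e s)
  then show ?case by (elim exec_RSetE) simp
next
  case (Diag a re im ev ure uim s)
  then show ?case by (elim exec_DiagE) simp
next
  case (Seq c\<^sub>1 s k\<^sub>1 s' c\<^sub>2 k\<^sub>2 t)
  from Seq.prems obtain m\<^sub>1 u m\<^sub>2 where *: "k' = m\<^sub>1 + m\<^sub>2"
      "exec diag D c\<^sub>1 s m\<^sub>1 u" "exec diag D c\<^sub>2 u m\<^sub>2 t'"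
    by (rule exec_SeqE)
  with Seq.IH(1)[OF *(2)] Seq.IH(2)[of m\<^sub>2 t'] show ?case by simp
next
  case (IfTrue b s c\<^sub>1 k t c\<^sub>2)
  from IfTrue.prems IfTrue.hyps obtain m where *: "k' = bcost b + 1 + m" "exec diag D c\<^sub>1 s m t'"
    by (auto elim: exec_IfE)
  with IfTrue.IH[OF *(2)] show ?case by simp
next
  case (IfFalse b s c\<^sub>2 k t c\<^sub>1)
  from IfFalse.prems IfFalse.hyps obtain m where *: "k' = bcost b + 1 + m" "exec diag D c\<^sub>2 s m t'"
    by (auto elim: exec_IfE)
  with IfFalse.IH[OF *(2)] show ?case by simp
next
  case (WhileFalse b s c)
  show ?case by (rule exec_WhileE[OF WhileFalse.prems]) (use WhileFalse.hyps in auto)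
next
  case (WhileTrue b s c k\<^sub>1 s' k\<^sub>2 t)
  obtain m\<^sub>1 u m\<^sub>2 where *: "k' = bcost b + 1 + m\<^sub>1 + m\<^sub>2"
      "exec diag D c s m\<^sub>1 u" "exec diag D (While b c) u m\<^sub>2 t'"
    by (rule exec_WhileE[OF WhileTrue.prems]) (use WhileTrue.hyps in auto)
  with WhileTrue.IH(1)[OF *(2)] WhileTrue.IH(2)[of m\<^sub>2 t'] show ?case by simp
qed

section \<open>Input convention\<close>

definition input_state :: "nat \<Rightarrow> nat \<Rightarrow> complex mat \<Rightarrow> state" where
  "input_state dA dB \<rho> =
     \<lparr>idx = (\<lambda>_. 0)(''dA'' := dA, ''dB'' := dB),
      arr = (\<lambda>(x, i, j).
        if i < dA * dB \<and> j < dA * dB then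
          (if x = ''rho_re'' then Re (\<rho> $$ (i, j))
           else if x = ''rho_im'' then Im (\<rho> $$ (i, j)) else 0)
        else 0)\<rparr>"

definition result :: "state \<Rightarrow> real" where
  "result s = arr s (''M'', 0, 0)"

end

(*
  All first-order data are taken from one diagonalization of rho with eigenvector columns u_l.
  The component of an eigenvalue is represented by the first index k that carries it; a pass over
  the columns adds up the reduced matrices of the projectors onto the u_l with the same eigenvalue,
  and a second, small diagonalization yields the eigenvalues of the reduced component. For the
  trace over B with n = dA dB, the reduction of a single column costs dA^2 dB operations; since
  every column belongs to exactly one eigenvalue, all reductions together cost n dA^2 dB = dA^3 dB^2
  operations and not n times as much. The at most n small diagonalizations cost n dA^3 = dA^4 dB,
  the comparisons of eigenvalues n^2, and the first diagonalization n^3 operations.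
*)

theory Submission
  imports Defs
begin

section \<open>Diagonalizations of Hermitian matrices\<close>

text \<open>The measure is defined without choices, through the projector onto an eigenspace (a
  \<open>THE\<close>), a kernel dimension and the roots of a characteristic polynomial, whereas a
  program sees only what \<open>diag\<close> returns: some eigenbasis in some order, with equal
  eigenvalues scattered over the columns. So each of the three notions is first computed from an
  arbitrary pair (e, U) satisfying \<open>diagonalization\<close>; the choice then cancels. The cost
  is the other obstacle. A single eigenvalue may own all n columns, so a worst-case bound for each
  component is too large to be multiplied by n. The cost of a component is therefore kept as a sum
  over the columns that depends on the state, up to the point where the sums over k and l can be
  exchanged.\<close>

lemma mat_adjoint_dim [simp]:
  "dim_row (mat_adjoint A) = dim_col A" "dim_col (mat_adjoint A) = dim_row A"
  by (auto simp: mat_adjoint_def)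

lemma mat_adjoint_carrier [simp]: "A \<in> carrier_mat n m \<Longrightarrow> mat_adjoint A \<in> carrier_mat m n"
  by auto

lemma mat_adjoint_index:
  "i < dim_col A \<Longrightarrow> j < dim_row A \<Longrightarrow> mat_adjoint A $$ (i, j) = conjugate (A $$ (j, i))"
  by (auto simp: mat_adjoint_def mat_of_rows_index)

lemma hermitian_mat_iff:
  assumes "A \<in> carrier_mat n n"
  shows "hermitian_mat A \<longleftrightarrow> (\<forall>i<n. \<forall>j<n. cnj (A $$ (j, i)) = A $$ (i, j))"
  using assms
  by (auto simp: hermitian_mat_def mat_eq_iff mat_adjoint_index)

lemma mat_adjoint_mult:
  fixes A B :: "complex mat"
  assumes "A \<in> carrier_mat n m" "B \<in> carrier_mat m k"
  shows "mat_adjoint (A * B) = mat_adjoint B * mat_adjoint A"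
proof (rule eq_matI)
  fix i j assume "i < dim_row (mat_adjoint B * mat_adjoint A)"
    "j < dim_col (mat_adjoint B * mat_adjoint A)"
  then have ij: "i < k" "j < n"
    using assms by auto
  then show "mat_adjoint (A * B) $$ (i, j) = (mat_adjoint B * mat_adjoint A) $$ (i, j)"
    using assms
    by (simp add: mat_adjoint_index scalar_prod_def mult.commute)
qed (use assms in auto)

lemma mat_eq_if_mult_vec_eq:
  fixes A B :: "'a :: comm_semiring_1 mat"
  assumes "A \<in> carrier_mat n m" "B \<in> carrier_mat n m"
    and "\<And>v. v \<in> carrier_vec m \<Longrightarrow> A *\<^sub>v v = B *\<^sub>v v"
  shows "A = B"
proof (rule eq_matI)
  fix i j assume ij: "i < dim_row B" "j < dim_col B"
  then have "(A *\<^sub>v unit_vec m j) $ i = (B *\<^sub>v unit_vec m j) $ i"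
    using assms by simp
  then show "A $$ (i, j) = B $$ (i, j)"
    using ij assms(1,2) by simp
qed (use assms in auto)

lemma smult_mat_mult_vec:
  fixes A :: "'a :: comm_semiring_0 mat"
  assumes "A \<in> carrier_mat n m" "v \<in> carrier_vec m"
  shows "(c \<cdot>\<^sub>m A) *\<^sub>v v = c \<cdot>\<^sub>v (A *\<^sub>v v)"
  using assms by (intro eq_vecI) (auto simp: scalar_prod_def sum_distrib_left mult.assoc)

text \<open>An idempotent fixes its range pointwise, so P Q = Q and Q P = P; the adjoint of the
  first product is the second one, whence P = Q. This makes the \<open>THE\<close> in
  \<open>orth_projector\<close> well defined.\<close>

lemma hermitian_idempotent_unique:
  assumes P: "P \<in> carrier_mat n n" "hermitian_mat P" "P * P = P"
    and Q: "Q \<in> carrier_mat n n" "hermitian_mat Q" "Q * Q = Q"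
    and range: "(\<lambda>v. P *\<^sub>v v) ` carrier_vec n = (\<lambda>v. Q *\<^sub>v v) ` carrier_vec n"
  shows "P = Q"
proof -
  have absorb: "X * Y = Y"
    if X: "X \<in> carrier_mat n n" "X * X = X" and Y: "Y \<in> carrier_mat n n"
      and sub: "(\<lambda>v. Y *\<^sub>v v) ` carrier_vec n \<subseteq> (\<lambda>v. X *\<^sub>v v) ` carrier_vec n"
    for X Y :: "complex mat"
  proof (rule mat_eq_if_mult_vec_eq[of _ n n])
    fix v :: "complex vec" assume v: "v \<in> carrier_vec n"
    then obtain w where w: "w \<in> carrier_vec n" "Y *\<^sub>v v = X *\<^sub>v w"
      using sub by auto
    have "X * Y *\<^sub>v v = X *\<^sub>v (X *\<^sub>v w)"
      using X Y v w
      by (simp add: assoc_mult_mat_vec[of _ n n _ n]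
          mult_mat_vec_carrier[of _ n n]
          mult_carrier_mat[of _ n n _ n])
    also have "\<dots> = Y *\<^sub>v v"
      using X w by (simp add: assoc_mult_mat_vec[of _ n n _ n, symmetric])
    finally show "X * Y *\<^sub>v v = Y *\<^sub>v v" .
  qed (use X Y in auto)
  have "P * Q = Q" "Q * P = P"
    using absorb[of P Q] absorb[of Q P] P Q range by auto
  then have "mat_adjoint (P * Q) = P"
    using P Q by (subst mat_adjoint_mult[of _ n n _ n]) (auto simp: hermitian_mat_def)
  then show ?thesis
    using \<open>P * Q = Q\<close> Q by (simp add: hermitian_mat_def)
qed

lemma orth_projector_eqI:
  assumes "P \<in> carrier_mat n n" "hermitian_mat P" "P * P = P"
    and "(\<lambda>v. P *\<^sub>v v) ` carrier_vec n = V"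
  shows "orth_projector n V = P"
  unfolding orth_projector_def
  using assms by (intro the_equality) (auto intro: hermitian_idempotent_unique)

text \<open>Presents a diagonal matrix as a Jordan form with blocks of size 1, so that dimensions of
  eigenspaces can be read off by counting blocks.\<close>

lemma jordan_matrix_diagonal:
  "jordan_matrix (map (Pair 1) as) = mat_diag (length as) (\<lambda>i. as ! i)"
proof (induction as)
  case Nil
  show ?case by (intro eq_matI) (auto simp: mat_diag_def)
next
  case (Cons a as)
  have len: "sum_list (map (fst \<circ> Pair (1::nat)) bs) = length bs" for bs :: "'a list"
    by (induction bs) auto
  have "jordan_matrix (map (Pair 1) (a # as)) =
      four_block_mat (jordan_block 1 a) (0\<^sub>m 1 (length as)) (0\<^sub>m (length as) 1)
        (mat_diag (length as) (\<lambda>i. as ! i))"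
    unfolding list.map(2) jordan_matrix_Cons Cons.IH by (simp add: len[simplified])
  also have "\<dots> = mat_diag (length (a # as)) (\<lambda>i. (a # as) ! i)"
    by (intro eq_matI) (auto simp: mat_diag_def jordan_block_def nth_Cons')
  finally show ?case .
qed

section \<open>Spectral data computed from an orthonormal eigenbasis\<close>

context
  fixes n A e U
  assumes diag: "diagonalization n A e U" and A: "A \<in> carrier_mat n n"
begin

private abbreviation "Us \<equiv> mat_adjoint U"
private abbreviation "E \<equiv> mat_diag n (\<lambda>i. complex_of_real (e i))"

private lemma U: "U \<in> carrier_mat n n"
  using diag by (simp add: diagonalization_def)

private lemma Us: "Us \<in> carrier_mat n n"
  using U by simp

private lemma Us_U: "Us * U = 1\<^sub>m n"
proof (rule eq_matI)
  fix i j assume "i < dim_row (1\<^sub>m n :: complex mat)" "j < dim_col (1\<^sub>m n :: complex mat)"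
  then have ij: "i < n" "j < n" by auto
  then have "(Us * U) $$ (i, j) = col U j \<bullet>c col U i"
    using U Us by (simp add: scalar_prod_def mat_adjoint_index mult.commute)
  then show "(Us * U) $$ (i, j) = 1\<^sub>m n $$ (i, j)"
    using ij diag by (auto simp: diagonalization_def)
qed (use U Us in auto)

private lemma U_Us: "U * Us = 1\<^sub>m n"
  using mat_mult_left_right_inverse[OF Us U Us_U] .

private lemma A_eq: "A = U * E * Us"
proof -
  have "A * U = U * E"
  proof (rule eq_matI)
    fix i j assume "i < dim_row (U * E)" "j < dim_col (U * E)"
    then have ij: "i < n" "j < n" using U by (auto simp: mat_diag_def)
    then have "(A *\<^sub>v col U j) $ i = (complex_of_real (e j) \<cdot>\<^sub>v col U j) $ i"
      using diag by (auto simp: diagonalization_def)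
    then show "(A * U) $$ (i, j) = (U * E) $$ (i, j)"
      using ij A U by (simp add: mat_diag_mult_right[OF U])
  qed (use A U in \<open>auto simp: mat_diag_def\<close>)
  then have "A * U * Us = U * E * Us" by simp
  then show ?thesis
    using A U Us by (simp add: assoc_mult_mat[OF A U Us] U_Us)
qed

private lemma similar_mat_E: "similar_mat A E"
  using A U Us U_Us Us_U A_eq by (intro similar_matI[of _ _ U Us n]) auto

lemma diagonalization_char_poly:
  "char_poly A = (\<Prod>i\<leftarrow>[0..<n]. [:- complex_of_real (e i), 1:])"
proof -
  have "char_poly A = char_poly E"
    by (rule char_poly_similar[OF similar_mat_E])
  also have "\<dots> = (\<Prod>a\<leftarrow>diag_mat E. [:- a, 1:])"
    by (rule char_poly_upper_triangular[of _ n]) (auto simp: mat_diag_def)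
  also have "diag_mat E = map (\<lambda>i. complex_of_real (e i)) [0..<n]"
    by (auto simp: diag_mat_def mat_diag_def)
  finally show ?thesis by (simp add: comp_def)
qed

lemma diagonalization_proots:
  "proots (char_poly A) = image_mset (\<lambda>i. complex_of_real (e i)) (mset [0..<n])"
proof -
  have "proots (\<Prod>i\<leftarrow>xs. [:- complex_of_real (e i), 1:]) =
      image_mset (\<lambda>i. complex_of_real (e i)) (mset xs)" for xs
  proof (induction xs)
    case (Cons x xs)
    have "(\<Prod>i\<leftarrow>xs. [:- complex_of_real (e i), 1:]) \<noteq> 0"
      by (induction xs) (auto simp del: mult_pCons_left)
    then show ?case
      using Cons by (simp add: proots_mult del: mult_pCons_left)
  qed auto
  then show ?thesis
    unfolding diagonalization_char_poly .
qed

lemma diagonalization_nonzero_eigenvalues: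
  "nonzero_eigenvalues A = image_mset e (filter_mset (\<lambda>i. e i \<noteq> 0) (mset [0..<n]))"
  unfolding nonzero_eigenvalues_def diagonalization_proots
  by (simp add: filter_mset_image_mset multiset.map_comp comp_def)

lemma diagonalization_eigenvalue: "eigenvalue A (complex_of_real \<eta>) \<longleftrightarrow> (\<exists>i<n. e i = \<eta>)"
proof -
  have "poly (\<Prod>i\<leftarrow>xs. [:- complex_of_real (e i), 1:]) (complex_of_real \<eta>) = 0
    \<longleftrightarrow> (\<exists>i\<in>set xs. e i = \<eta>)" for xs
    by (induction xs) auto
  from this[of "[0..<n]"] show ?thesis
    unfolding eigenvalue_root_char_poly[OF A] diagonalization_char_poly by auto
qed

text \<open>The generalized eigenspace of order 1 is the kernel of \<open>char_matrix\<close>, and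
  every Jordan block of size 1 with value \<eta> contributes \<open>min 1 1\<close> to its
  dimension.\<close>

lemma diagonalization_eigenspace_dim: "eigenspace_dim A \<eta> = card {i. i < n \<and> e i = \<eta>}"
proof -
  let ?as = "map (\<lambda>i. complex_of_real (e i)) [0..<n]"
  have "jordan_matrix (map (Pair 1) ?as) = E"
    unfolding jordan_matrix_diagonal by (intro eq_matI) (auto simp: mat_diag_def)
  then have "jordan_nf A (map (Pair 1) ?as)"
    using similar_mat_E by (auto simp: jordan_nf_def)
  then have "dim_gen_eigenspace A (complex_of_real \<eta>) 1 =
      (\<Sum>m \<leftarrow> map fst [(m, a)\<leftarrow>map (Pair 1) ?as. a = complex_of_real \<eta>]. min 1 m)"
    by (rule dim_gen_eigenspace)
  also have "\<dots> = length (filter (\<lambda>i. e i = \<eta>) [0..<n])"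
  proof -
    have "(\<Sum>m \<leftarrow> map fst [(m, a)\<leftarrow>map (Pair 1) (map (\<lambda>i. complex_of_real (e i)) xs).
        a = complex_of_real \<eta>]. min 1 m) = length (filter (\<lambda>i. e i = \<eta>) xs)" for xs
      by (induction xs) auto
    then show ?thesis .
  qed
  also have "\<dots> = card {i. i < n \<and> e i = \<eta>}"
    by (simp add: length_filter_conv_card) (rule arg_cong[of _ _ card], auto)
  finally show ?thesis
    using A by (simp add: eigenspace_dim_def dim_gen_eigenspace_def char_matrix_def)
qed

text \<open>The right-hand side mentions the eigenbasis, the left-hand side does not. With I the 0-1
  diagonal matrix of the indices that carry \<eta>, the matrix P = U I U* is Hermitian and
  idempotent and its range is the eigenspace; uniqueness of such a matrix does the rest.\<close>

lemma diagonalization_orth_projector: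
  "orth_projector n (eigenspace A \<eta>) =
     mat n n (\<lambda>(i, j). \<Sum>l<n. if e l = \<eta> then U $$ (i, l) * cnj (U $$ (j, l)) else 0)"
    (is "_ = ?P")
proof -
  define P where "P = ?P"
  let ?I = "mat_diag n (\<lambda>l. if e l = \<eta> then 1 else 0 :: complex)"
  have I: "?I \<in> carrier_mat n n" by simp
  have P_eq: "P = U * ?I * Us"
    unfolding P_def mat_diag_mult_right[OF U]
  proof (rule eq_matI)
    fix i j assume "i < dim_row (mat n n (\<lambda>(i, j). U $$ (i, j) * (if e j = \<eta> then 1 else 0)) * Us)"
      "j < dim_col (mat n n (\<lambda>(i, j). U $$ (i, j) * (if e j = \<eta> then 1 else 0)) * Us)"
    then show "?P $$ (i, j) =
        (mat n n (\<lambda>(i, j). U $$ (i, j) * (if e j = \<eta> then 1 else 0)) * Us) $$ (i, j)"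
      using U Us by (auto simp: scalar_prod_def mat_adjoint_index lessThan_atLeast0 intro!: sum.cong)
  qed (use U Us in auto)
  have P: "P \<in> carrier_mat n n" by (simp add: P_def)
  have herm: "hermitian_mat P"
    unfolding hermitian_mat_iff[OF P] by (auto simp: P_def intro!: sum.cong simp: mult.commute)
  have "P * P = U * (?I * (Us * U) * ?I) * Us"
    unfolding P_eq using U Us I
    by (simp add: assoc_mult_mat[of _ n n _ n _ n]
        mult_carrier_mat[of _ n n _ n])
  also have "?I * (Us * U) * ?I = ?I"
    unfolding Us_U right_mult_one_mat[OF I] by (simp add: if_distrib cong: if_cong)
  finally have idem: "P * P = P" unfolding P_eq .
  have eig: "eigenspace A \<eta> = {v \<in> carrier_vec n. A *\<^sub>v v = complex_of_real \<eta> \<cdot>\<^sub>v v}"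
  proof -
    have "char_matrix A (complex_of_real \<eta>) *\<^sub>v v = A *\<^sub>v v - complex_of_real \<eta> \<cdot>\<^sub>v v"
      if "v \<in> carrier_vec n" for v
      using that A
      by (intro eq_vecI) (auto simp: char_matrix_def add_mult_distrib_mat_vec[of _ n n])
    moreover have "(w - z = 0\<^sub>v n) = (w = z)"
      if "w \<in> carrier_vec n" "z \<in> carrier_vec n" for w z :: "complex vec"
      using that by (auto simp: vec_eq_iff)
    ultimately show ?thesis
      using A unfolding eigenspace_def mat_kernel_def
      by (auto simp: char_matrix_def)
  qed
  \<comment> \<open>In the coordinates w = U* v the eigenvalue equation reads e_i w_i = \<eta> w_i,
    so w is supported on the indices carrying \<eta> and I fixes it.\<close>
  have fixed: "P *\<^sub>v v = v" if v: "v \<in> carrier_vec n" and Av: "A *\<^sub>v v = complex_of_real \<eta> \<cdot>\<^sub>v v" for v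
  proof -
    define w where "w = Us *\<^sub>v v"
    have w: "w \<in> carrier_vec n" using Us v by (simp add: w_def)
    have Uw: "U *\<^sub>v w = v"
      using U Us v by (simp add: w_def assoc_mult_mat_vec[of _ n n _ n, symmetric] U_Us)
    have "E *\<^sub>v w = (Us * U) *\<^sub>v (E *\<^sub>v w)"
      using w by (simp add: Us_U mult_mat_vec_carrier[of _ n n])
    also have "\<dots> = Us *\<^sub>v (A *\<^sub>v v)"
      using U Us v
      by (simp add: A_eq w_def assoc_mult_mat_vec[of _ n n _ n]
          mult_mat_vec_carrier[of _ n n]
          mult_carrier_mat[of _ n n _ n])
    also have "\<dots> = complex_of_real \<eta> \<cdot>\<^sub>v w"
      unfolding Av w_def using Us v by (simp add: mult_mat_vec)
    finally have E: "E *\<^sub>v w = complex_of_real \<eta> \<cdot>\<^sub>v w" .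
    have diag_vec: "(mat_diag n f *\<^sub>v w) $ i = f i * w $ i" if "i < n" for f :: "nat \<Rightarrow> complex" and i
      using that w
      by (simp add: mat_diag_def scalar_prod_def if_distrib[of "\<lambda>x. x * _"] cong: if_cong)
    have "?I *\<^sub>v w = w"
    proof (rule eq_vecI)
      fix i assume "i < dim_vec w"
      then have i: "i < n" using w by simp
      have "complex_of_real (e i) * w $ i = complex_of_real \<eta> * w $ i"
        using arg_cong[OF E, of "\<lambda>v. v $ i"] w i by (simp add: diag_vec)
      then show "(?I *\<^sub>v w) $ i = w $ i"
        using i by (auto simp: diag_vec)
    qed (use w in \<open>auto simp: mat_diag_def\<close>)
    then show ?thesis
      unfolding P_eq using U Us I v w Uw
      by (simp add: assoc_mult_mat_vec[of _ n n _ n]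
          mult_mat_vec_carrier[of _ n n]
          mult_carrier_mat[of _ n n _ n] flip: w_def)
  qed
  \<comment> \<open>The other inclusion: E I = \<eta> I, so the range of P consists of solutions of
    A v = \<eta> v.\<close>
  have "A * P = complex_of_real \<eta> \<cdot>\<^sub>m P"
  proof -
    have "A * P = U * (E * (Us * U) * ?I) * Us"
      unfolding P_eq using U Us I
      by (subst A_eq) (simp add: assoc_mult_mat[of _ n n _ n _ n]
          mult_carrier_mat[of _ n n _ n])
    also have "E * (Us * U) * ?I = complex_of_real \<eta> \<cdot>\<^sub>m ?I"
      unfolding Us_U right_mult_one_mat[OF mat_diag_dim] mat_diag_diag
      by (intro eq_matI) (auto simp: mat_diag_def)
    also have "U * (complex_of_real \<eta> \<cdot>\<^sub>m ?I) * Us = complex_of_real \<eta> \<cdot>\<^sub>m P"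
      unfolding P_eq using U Us I
      by (simp add: mult_smult_distrib[of _ n n _ n] mult_smult_assoc_mat[of _ n n _ n])
    finally show ?thesis .
  qed
  then have "A *\<^sub>v (P *\<^sub>v v) = complex_of_real \<eta> \<cdot>\<^sub>v (P *\<^sub>v v)" if "v \<in> carrier_vec n" for v
    unfolding assoc_mult_mat_vec[OF A P that, symmetric]
    using smult_mat_mult_vec[OF P that] by simp
  then have range: "(\<lambda>v. P *\<^sub>v v) ` carrier_vec n = eigenspace A \<eta>"
  proof (intro subset_antisym subsetI)
    fix v assume "v \<in> eigenspace A \<eta>"
    then have "v \<in> carrier_vec n" "P *\<^sub>v v = v"
      unfolding eig using fixed by blast+
    then show "v \<in> (\<lambda>v. P *\<^sub>v v) ` carrier_vec n"
      by (metis image_eqI)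
  qed (use P in \<open>auto simp: eig intro!: mult_mat_vec_carrier\<close>)
  show ?thesis
    using orth_projector_eqI[OF P herm idem range] unfolding P_def .
qed

end

section \<open>Reasoning about the cost and the effect of programs\<close>

text \<open>A total-correctness triple in which K bounds the cost only from above; the slack lets
  branches of different cost share one budget.\<close>

definition runs ::
  "diagonalizer \<Rightarrow> (nat \<Rightarrow> nat) \<Rightarrow> com \<Rightarrow> state \<Rightarrow> nat \<Rightarrow> (state \<Rightarrow> bool) \<Rightarrow> bool" where
  "runs diag D c s K Q \<longleftrightarrow> (\<exists>k t. exec diag D c s k t \<and> k \<le> K \<and> Q t)"

primrec imods :: "com \<Rightarrow> vname set" where
  "imods Skip = {}"
| "imods (ISet x a) = {x}"
| "imods (RSet x i j e) = {}"
| "imods (Diag a re im ev ure uim) = {}"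
| "imods (Seq c\<^sub>1 c\<^sub>2) = imods c\<^sub>1 \<union> imods c\<^sub>2"
| "imods (If b c\<^sub>1 c\<^sub>2) = imods c\<^sub>1 \<union> imods c\<^sub>2"
| "imods (While b c) = imods c"

primrec amods :: "com \<Rightarrow> vname set" where
  "amods Skip = {}"
| "amods (ISet x a) = {}"
| "amods (RSet x i j e) = {x}"
| "amods (Diag a re im ev ure uim) = {ev, ure, uim}"
| "amods (Seq c\<^sub>1 c\<^sub>2) = amods c\<^sub>1 \<union> amods c\<^sub>2"
| "amods (If b c\<^sub>1 c\<^sub>2) = amods c\<^sub>1 \<union> amods c\<^sub>2"
| "amods (While b c) = amods c"

text \<open>The modified variables are read off the syntax. \<open>runs_weaken\<close>,
  \<open>runs_Seq\<close> and \<open>runs_For\<close> supply the frame in their premises, so that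
  invariants need not list what stays unchanged.\<close>

definition frame :: "com \<Rightarrow> state \<Rightarrow> state \<Rightarrow> bool" where
  "frame c s t \<longleftrightarrow>
     (\<forall>x. x \<notin> imods c \<longrightarrow> idx t x = idx s x) \<and>
     (\<forall>x i j. x \<notin> amods c \<longrightarrow> arr t (x, i, j) = arr s (x, i, j))"

lemma exec_frame: "exec diag D c s k t \<Longrightarrow> frame c s t"
  by (induction rule: exec.induct) (auto simp: frame_def write_diag_def)

lemma runs_weaken:
  assumes "runs diag D c s K Q" "K \<le> K'" "\<And>t. frame c s t \<Longrightarrow> Q t \<Longrightarrow> Q' t"
  shows "runs diag D c s K' Q'"
  using assms exec_frame unfolding runs_def by (meson order_trans)

lemma runs_Skip [simp]: "runs diag D Skip s K Q \<longleftrightarrow> Q s"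
  unfolding runs_def by (auto intro: exec.Skip elim: exec_SkipE)

lemma runs_ISet [simp]:
  "runs diag D (ISet x a) s K Q \<longleftrightarrow>
     icost a + 1 \<le> K \<and> Q (s\<lparr>idx := (idx s)(x := ival a s)\<rparr>)"
  unfolding runs_def by (auto intro: exec.ISet elim!: exec_ISetE)
    (metis exec.ISet One_nat_def add.commute plus_1_eq_Suc)

lemma runs_RSet [simp]:
  "runs diag D (RSet x i j e) s K Q \<longleftrightarrow>
     icost i + icost j + rcost e + 1 \<le> K \<and>
     Q (s\<lparr>arr := (arr s)((x, ival i s, ival j s) := rval e s)\<rparr>)"
  unfolding runs_def by (auto intro: exec.RSet elim!: exec_RSetE)
    (metis exec.RSet One_nat_def add.commute plus_1_eq_Suc)

text \<open>Stated as equivalences, this rule and its companions let simp execute loop-free code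
  symbolically. The inequality in front keeps the subtraction from K exact.\<close>

lemma runs_If [simp]:
  "runs diag D (If b c\<^sub>1 c\<^sub>2) s K Q \<longleftrightarrow>
     bcost b + 1 \<le> K \<and>
     (if bval b s then runs diag D c\<^sub>1 s (K - (bcost b + 1)) Q
      else runs diag D c\<^sub>2 s (K - (bcost b + 1)) Q)"
    (is "?L \<longleftrightarrow> ?R")
proof
  assume ?L
  then obtain k t where "exec diag D (If b c\<^sub>1 c\<^sub>2) s k t" "k \<le> K" "Q t"
    by (auto simp: runs_def)
  then show ?R
    unfolding runs_def by (elim exec_IfE) fastforce+
next
  assume R: ?R
  then obtain k t where kt: "exec diag D (if bval b s then c\<^sub>1 else c\<^sub>2) s k t"
      "k \<le> K - (bcost b + 1)" "Q t"
    by (auto simp: runs_def split: if_splits)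
  then have "exec diag D (If b c\<^sub>1 c\<^sub>2) s (bcost b + 1 + k) t"
    by (cases "bval b s") (auto intro: exec.IfTrue[simplified] exec.IfFalse[simplified])
  moreover have "bcost b + 1 + k \<le> K" using R kt by linarith
  ultimately show ?L using kt unfolding runs_def by blast
qed

lemma runs_Seq_iff:
  "runs diag D (Seq c\<^sub>1 c\<^sub>2) s K Q \<longleftrightarrow>
     (\<exists>k u. exec diag D c\<^sub>1 s k u \<and> k \<le> K \<and> runs diag D c\<^sub>2 u (K - k) Q)"
    (is "?L \<longleftrightarrow> ?R")
proof
  assume ?L
  then obtain k\<^sub>1 k\<^sub>2 u t where "exec diag D c\<^sub>1 s k\<^sub>1 u" "exec diag D c\<^sub>2 u k\<^sub>2 t" "k\<^sub>1 + k\<^sub>2 \<le> K" "Q t"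
    unfolding runs_def by (auto elim!: exec_SeqE)
  moreover from this have "k\<^sub>1 \<le> K" "k\<^sub>2 \<le> K - k\<^sub>1" by auto
  ultimately show ?R unfolding runs_def by blast
next
  assume ?R
  then obtain k\<^sub>1 k\<^sub>2 u t where *: "exec diag D c\<^sub>1 s k\<^sub>1 u" "exec diag D c\<^sub>2 u k\<^sub>2 t"
    "k\<^sub>1 \<le> K" "k\<^sub>2 \<le> K - k\<^sub>1" "Q t"
    unfolding runs_def by blast
  then have "exec diag D (Seq c\<^sub>1 c\<^sub>2) s (k\<^sub>1 + k\<^sub>2) t" "k\<^sub>1 + k\<^sub>2 \<le> K"
    by (auto intro: exec.Seq)
  with * show ?L unfolding runs_def by blast
qed

lemma runs_Seq:
  assumes "runs diag D c\<^sub>1 s K\<^sub>1 P"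
    and "\<And>u. frame c\<^sub>1 s u \<Longrightarrow> P u \<Longrightarrow> runs diag D c\<^sub>2 u K\<^sub>2 Q"
    and "K\<^sub>1 + K\<^sub>2 \<le> K"
  shows "runs diag D (Seq c\<^sub>1 c\<^sub>2) s K Q"
proof -
  from assms(1) obtain k u where u: "exec diag D c\<^sub>1 s k u" "k \<le> K\<^sub>1" "P u"
    by (auto simp: runs_def)
  then have "runs diag D c\<^sub>2 u (K - k) Q"
    using assms(3) by (intro runs_weaken[OF assms(2)] exec_frame) auto
  moreover have "k \<le> K" using u assms(3) by simp
  ultimately show ?thesis using u unfolding runs_Seq_iff by blast
qed

lemma runs_Seq_Skip [simp]: "runs diag D (Seq Skip c) s K Q \<longleftrightarrow> runs diag D c s K Q"
  unfolding runs_Seq_iff by (metis exec.Skip exec_SkipE zero_le diff_zero)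

lemma runs_Seq_RSet [simp]:
  "runs diag D (Seq (RSet x i j e) c) s K Q \<longleftrightarrow>
     icost i + icost j + rcost e + 1 \<le> K \<and>
     runs diag D c (s\<lparr>arr := (arr s)((x, ival i s, ival j s) := rval e s)\<rparr>)
       (K - (icost i + icost j + rcost e + 1)) Q"
  unfolding runs_Seq_iff by (metis exec.RSet exec_RSetE)

lemma runs_Seq_ISet [simp]:
  "runs diag D (Seq (ISet x a) c) s K Q \<longleftrightarrow>
     icost a + 1 \<le> K \<and>
     runs diag D c (s\<lparr>idx := (idx s)(x := ival a s)\<rparr>) (K - (icost a + 1)) Q"
  unfolding runs_Seq_iff by (metis exec.ISet exec_ISetE)

text \<open>The continuation moves into both branches, so that symbolic execution can go on in each
  of them.\<close>

lemma runs_Seq_If [simp]: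
  "runs diag D (Seq (If b c\<^sub>1 c\<^sub>2) c) s K Q \<longleftrightarrow>
     runs diag D (If b (Seq c\<^sub>1 c) (Seq c\<^sub>2 c)) s K Q" (is "?L \<longleftrightarrow> ?R")
proof
  assume ?L
  then show ?R
    unfolding runs_Seq_iff runs_If by (elim exE conjE exec_IfE) (fastforce simp: runs_Seq_iff)+
next
  assume ?R
  then obtain k u where "exec diag D (if bval b s then c\<^sub>1 else c\<^sub>2) s k u"
    "k \<le> K - (bcost b + 1)" "bcost b + 1 \<le> K" "runs diag D c u (K - (bcost b + 1) - k) Q"
    by (auto simp: runs_Seq_iff split: if_splits)
  moreover from this(1) have "exec diag D (If b c\<^sub>1 c\<^sub>2) s (bcost b + 1 + k) u"
    by (cases "bval b s") (auto intro: exec.IfTrue[simplified] exec.IfFalse[simplified])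
  ultimately show ?L
    unfolding runs_Seq_iff by (intro exI[of _ "bcost b + 1 + k"] exI[of _ u]) auto
qed

text \<open>The last premise ranges over all diagonalizations, since the routine promises no more
  than to return one of them.\<close>

lemma runs_Diag:
  assumes "diagonalizes diag" "N = ival a s" "hermitian_mat (read_mat N re im s)"
    and "icost a + D N + 1 \<le> K"
    and "\<And>e U t. diagonalization N (read_mat N re im s) e U \<Longrightarrow>
      t = write_diag N ev ure uim (e, U) s \<Longrightarrow> Q t"
  shows "runs diag D (Diag a re im ev ure uim) s K Q"
proof -
  let ?A = "read_mat N re im s"
  have "diagonalization N ?A (fst (diag ?A)) (snd (diag ?A))"
    using assms(1,3) by (simp add: diagonalizes_def read_mat_def)
  then have "Q (write_diag N ev ure uim (diag ?A) s)"
    using assms(5) by (metis prod.collapse)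
  then show ?thesis
    using exec.Diag[of diag D a re im ev ure uim s] assms(2,4) unfolding runs_def by blast
qed

section \<open>Counting loops\<close>

definition For :: "vname \<Rightarrow> vname \<Rightarrow> com \<Rightarrow> com" where
  "For x y c =
     Seq (ISet x (INum 0))
       (While (ILess (IVar x) (IVar y)) (Seq c (ISet x (IAdd (IVar x) (INum 1)))))"

lemma imods_For [simp]: "imods (For x y c) = insert x (imods c)"
  by (auto simp: For_def)

lemma amods_For [simp]: "amods (For x y c) = amods c"
  by (auto simp: For_def)

text \<open>Besides \<open>T i\<close>, a round pays 2 for the test and 2 for the increment; the 3
  pays for the initialization and the final failing test. \<open>T\<close> may vary with the round,
  which the amortized count relies on. The invariant speaks of the arrays only: the counter is known
  to be i, and the other index variables come from the frame.\<close>

lemma runs_For: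
  assumes fresh: "x \<notin> imods c" "y \<notin> insert x (imods c)"
    and N: "N = idx s y"
    and init: "I 0 (arr s)"
    and body: "\<And>i u. i < N \<Longrightarrow> frame (For x y c) s u \<Longrightarrow> idx u x = i \<Longrightarrow> I i (arr u) \<Longrightarrow>
      runs diag D c u (T i) (\<lambda>t. I (Suc i) (arr t))"
    and bound: "3 + (\<Sum>i<N. T i + 4) \<le> K"
    and post: "\<And>t. frame (For x y c) s t \<Longrightarrow> I N (arr t) \<Longrightarrow> Q t"
  shows "runs diag D (For x y c) s K Q"
proof -
  let ?W = "While (ILess (IVar x) (IVar y)) (Seq c (ISet x (IAdd (IVar x) (INum 1))))"
  have loop: "runs diag D ?W u (2 + (\<Sum>i\<in>{i..<N}. T i + 4)) (\<lambda>t. I N (arr t))"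
    if "frame (For x y c) s u" "idx u x = i" "I i (arr u)" "i \<le> N" for i u
    using that
  proof (induction "N - i" arbitrary: i u)
    case 0
    then have "i = N" "idx u y = N"
      using N fresh by (auto simp: frame_def)
    then have "exec diag D ?W u 2 u"
      using exec.WhileFalse[of "ILess (IVar x) (IVar y)" u diag D] 0
      by (simp add: numeral_2_eq_2)
    then show ?case
      using 0 \<open>i = N\<close> unfolding runs_def by auto
  next
    case (Suc d)
    then have i: "i < N" and y: "idx u y = N"
      using N fresh by (auto simp: frame_def)
    obtain k\<^sub>1 v where v: "exec diag D c u k\<^sub>1 v" "k\<^sub>1 \<le> T i" "I (Suc i) (arr v)"
      using body[OF i Suc.prems(1-3)] by (auto simp: runs_def)
    have fr: "frame c u v" using exec_frame v(1) .
    let ?w = "v\<lparr>idx := (idx v)(x := Suc i)\<rparr>"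
    have vx: "idx v x = i" using fr fresh Suc.prems by (simp add: frame_def)
    then have "exec diag D (Seq c (ISet x (IAdd (IVar x) (INum 1)))) u (k\<^sub>1 + 2) ?w"
      using exec.Seq[OF v(1) exec.ISet[of diag D x "IAdd (IVar x) (INum 1)" v]] by simp
    moreover have "frame (For x y c) s ?w"
      using Suc.prems(1) fr fresh by (auto simp: frame_def)
    then have "runs diag D ?W ?w (2 + (\<Sum>i\<in>{Suc i..<N}. T i + 4)) (\<lambda>t. I N (arr t))"
      using Suc.hyps(2) v i by (intro Suc.hyps(1)) auto
    then obtain k\<^sub>2 t where t: "exec diag D ?W ?w k\<^sub>2 t"
      "k\<^sub>2 \<le> 2 + (\<Sum>i\<in>{Suc i..<N}. T i + 4)" "I N (arr t)"
      by (auto simp: runs_def)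
    ultimately have "exec diag D ?W u (2 + (k\<^sub>1 + 2) + k\<^sub>2) t"
      using exec.WhileTrue[of "ILess (IVar x) (IVar y)" u diag D _ "k\<^sub>1 + 2" ?w k\<^sub>2 t] i y Suc.prems
      by simp
    moreover have "2 + (k\<^sub>1 + 2) + k\<^sub>2 \<le> 2 + (\<Sum>i\<in>{i..<N}. T i + 4)"
      using t(2) v(2) i by (simp add: sum.atLeast_Suc_lessThan[of i N])
    ultimately show ?case using t(3) unfolding runs_def by blast
  qed
  let ?s = "s\<lparr>idx := (idx s)(x := 0)\<rparr>"
  have "runs diag D ?W ?s (2 + (\<Sum>i<N. T i + 4)) (\<lambda>t. I N (arr t))"
    using loop[of ?s 0] init by (simp add: frame_def lessThan_atLeast0)
  then have "runs diag D (For x y c) s K (\<lambda>t. I N (arr t))"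
    unfolding For_def using bound by (auto intro: runs_weaken)
  then show ?thesis
    by (rule runs_weaken) (auto intro: post)
qed

section \<open>The algorithm\<close>

abbreviation Cell :: "vname \<Rightarrow> rexp" where
  "Cell x \<equiv> RGet x (INum 0) (INum 0)"

abbreviation SetCell :: "vname \<Rightarrow> rexp \<Rightarrow> com" where
  "SetCell x e \<equiv> RSet x (INum 0) (INum 0) e"

abbreviation Ev :: "vname \<Rightarrow> rexp" where
  "Ev l \<equiv> RGet ''e'' (IVar l) (INum 0)"

definition is_first_prog :: com where
  "is_first_prog =
     Seq (SetCell ''first'' (RNum 1))
       (For ''l'' ''k'' (If (REq (Ev ''l'') (Ev ''k'')) (SetCell ''first'' (RNum 0)) Skip))"

definition zero_prog :: com where
  "zero_prog = For ''x'' ''p'' (For ''z'' ''p''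
     (Seq (RSet ''Tre'' (IVar ''x'') (IVar ''z'') (RNum 0))
       (RSet ''Tim'' (IVar ''x'') (IVar ''z'') (RNum 0))))"

text \<open>The basis vector with kept index \<open>x\<close> and traced index \<open>y\<close> has row number \<open>x * w + y * v\<close>:
  \<open>(w, v)\<close> is \<open>(dB, 1)\<close> when B is traced out and \<open>(1, dB)\<close> when A is traced out.\<close>

abbreviation Row :: "vname \<Rightarrow> iexp" where
  "Row x \<equiv> IAdd (IMul (IVar x) (IVar ''w'')) (IMul (IVar ''y'') (IVar ''v''))"

text \<open>For u = a + b i and u' = c + d i the product of u with the conjugate of u' has real part
  a c + b d and imaginary part b c - a d. The factor taken from \<open>Ev ''k''\<close> turns the
  projector into the eigencomponent.\<close>

definition add_prog :: com where
  "add_prog = For ''x'' ''p'' (For ''z'' ''p'' (For ''y'' ''q''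
     (Seq
       (RSet ''Tre'' (IVar ''x'') (IVar ''z'')
         (RAdd (RGet ''Tre'' (IVar ''x'') (IVar ''z''))
           (RMul (Ev ''k'')
             (RAdd
               (RMul (RGet ''ure'' (Row ''x'') (IVar ''l'')) (RGet ''ure'' (Row ''z'') (IVar ''l'')))
               (RMul (RGet ''uim'' (Row ''x'') (IVar ''l'')) (RGet ''uim'' (Row ''z'') (IVar ''l'')))))))
       (RSet ''Tim'' (IVar ''x'') (IVar ''z'')
         (RAdd (RGet ''Tim'' (IVar ''x'') (IVar ''z''))
           (RMul (Ev ''k'')
             (RSub
               (RMul (RGet ''uim'' (Row ''x'') (IVar ''l'')) (RGet ''ure'' (Row ''z'') (IVar ''l'')))
               (RMul (RGet ''ure'' (Row ''x'') (IVar ''l'')) (RGet ''uim'' (Row ''z'') (IVar ''l''))))))))))"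

text \<open>The multiplicity is counted in a real cell because it later enters a logarithm and the
  machine cannot convert an index into a real.\<close>

definition gather_prog :: com where
  "gather_prog = For ''l'' ''n''
     (If (REq (Ev ''l'') (Ev ''k''))
       (Seq (SetCell ''dim'' (RAdd (Cell ''dim'') (RNum 1))) add_prog)
       Skip)"

text \<open>The strict comparison chooses the upper multiple only if it is strictly closer, so ties
  go down as in \<open>nim\<close>. There is no absolute value among the operations, hence the sign
  test. The subtraction from \<open>acc\<close> realizes the minus sign in front of the
  measure.\<close>

definition summand_prog :: com where
  "summand_prog =
     (let h = RGet ''h'' (IVar ''i'') (INum 0) in
      Seq (SetCell ''lo'' (RMul (Ev ''k'') (RFloor (RDiv h (Ev ''k'')))))
     (Seq (SetCell ''hi'' (RMul (Ev ''k'') (RCeil (RDiv h (Ev ''k'')))))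
     (Seq (If (RLess (RSub (Cell ''hi'') h) (RSub h (Cell ''lo'')))
            (SetCell ''d'' (RSub h (Cell ''hi'')))
            (SetCell ''d'' (RSub h (Cell ''lo''))))
     (Seq (If (RLess (Cell ''d'') (RNum 0)) (SetCell ''d'' (RSub (RNum 0) (Cell ''d''))) Skip)
          (SetCell ''acc'' (RSub (Cell ''acc'')
             (RMul (Cell ''d'') (RLog (RDiv h (RMul (Ev ''k'') (Cell ''dim'')))))))))))"

text \<open>Skipping zeros also settles the eigenvalue 0 of \<rho>: its component is the zero
  matrix, all of whose eigenvalues are skipped.\<close>

definition sum_prog :: com where
  "sum_prog = For ''i'' ''p''
     (If (REq (RGet ''h'' (IVar ''i'') (INum 0)) (RNum 0)) Skip summand_prog)"

definition eigenvalue_prog :: com where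
  "eigenvalue_prog =
     Seq (SetCell ''dim'' (RNum 0)) (Seq zero_prog (Seq gather_prog
       (Seq (Diag (IVar ''p'') ''Tre'' ''Tim'' ''h'' ''vre'' ''vim'') sum_prog)))"

definition reduced_prog :: com where
  "reduced_prog = For ''k'' ''n''
     (Seq is_first_prog (If (REq (Cell ''first'') (RNum 1)) eigenvalue_prog Skip))"

definition params_prog :: "iexp \<Rightarrow> iexp \<Rightarrow> iexp \<Rightarrow> iexp \<Rightarrow> com \<Rightarrow> com" where
  "params_prog p q w v c =
     Seq (ISet ''p'' p) (Seq (ISet ''q'' q) (Seq (ISet ''w'' w) (Seq (ISet ''v'' v) c)))"

text \<open>\<open>acc\<close> is not reset between the two reductions, so at the end it holds the
  sum of \<open>M_A\<close> and \<open>M_B\<close>.\<close>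

definition measure_prog :: com where
  "measure_prog =
     Seq (ISet ''n'' (IMul (IVar ''dA'') (IVar ''dB'')))
    (Seq (Diag (IVar ''n'') ''rho_re'' ''rho_im'' ''e'' ''ure'' ''uim'')
    (Seq (SetCell ''acc'' (RNum 0))
    (Seq (params_prog (IVar ''dA'') (IVar ''dB'') (IVar ''dB'') (INum 1) reduced_prog)
    (Seq (params_prog (IVar ''dB'') (IVar ''dA'') (INum 1) (IVar ''dB'') reduced_prog)
         (SetCell ''M'' (RDiv (Cell ''acc'') (RNum 2)))))))"

lemma imods_progs [simp]:
  "imods is_first_prog = {''l''}"
  "imods zero_prog = {''x'', ''z''}"
  "imods add_prog = {''x'', ''z'', ''y''}"
  "imods gather_prog = {''l'', ''x'', ''z'', ''y''}"
  "imods summand_prog = {}"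
  "imods sum_prog = {''i''}"
  "imods eigenvalue_prog = {''x'', ''z'', ''y'', ''l'', ''i''}"
  "imods reduced_prog = {''k'', ''l'', ''x'', ''z'', ''y'', ''i''}"
  unfolding is_first_prog_def zero_prog_def add_prog_def gather_prog_def summand_prog_def
    sum_prog_def eigenvalue_prog_def reduced_prog_def Let_def by auto

lemma amods_progs [simp]:
  "amods is_first_prog = {''first''}"
  "amods zero_prog = {''Tre'', ''Tim''}"
  "amods add_prog = {''Tre'', ''Tim''}"
  "amods gather_prog = {''dim'', ''Tre'', ''Tim''}"
  "amods summand_prog = {''lo'', ''hi'', ''d'', ''acc''}"
  "amods sum_prog = {''lo'', ''hi'', ''d'', ''acc''}"
  "amods eigenvalue_prog =
     {''dim'', ''Tre'', ''Tim'', ''h'', ''vre'', ''vim'', ''lo'', ''hi'', ''d'', ''acc''}"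
  "amods reduced_prog =
     {''first'', ''dim'', ''Tre'', ''Tim'', ''h'', ''vre'', ''vim'', ''lo'', ''hi'', ''d'', ''acc''}"
  unfolding is_first_prog_def zero_prog_def add_prog_def gather_prog_def summand_prog_def
    sum_prog_def eigenvalue_prog_def reduced_prog_def Let_def by auto

section \<open>Correctness and cost of the algorithm\<close>

lemma frame_idx: "frame c s t \<Longrightarrow> x \<notin> imods c \<Longrightarrow> idx t x = idx s x"
  by (simp add: frame_def)

lemma frame_arr: "frame c s t \<Longrightarrow> x \<notin> amods c \<Longrightarrow> arr t (x, i, j) = arr s (x, i, j)"
  by (simp add: frame_def)

lemma runs_is_first_prog:
  "runs diag D is_first_prog s (4 + 7 * idx s ''k'')
     (\<lambda>t. arr t (''first'', 0, 0) =
       (if \<exists>l<idx s ''k''. arr s (''e'', l, 0) = arr s (''e'', idx s ''k'', 0) then 0 else 1))"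
  unfolding is_first_prog_def
proof (subst runs_Seq_RSet, intro conjI)
  show "runs diag D
     (For ''l'' ''k'' (If (REq (Ev ''l'') (Ev ''k'')) (SetCell ''first'' (RNum 0)) Skip))
     (s\<lparr>arr := (arr s)((''first'', ival (INum 0) s, ival (INum 0) s) := rval (RNum 1) s)\<rparr>)
     (4 + 7 * idx s ''k'' - (icost (INum 0) + icost (INum 0) + rcost (RNum 1) + 1))
     (\<lambda>t. arr t (''first'', 0, 0) =
       (if \<exists>l<idx s ''k''. arr s (''e'', l, 0) = arr s (''e'', idx s ''k'', 0) then 0 else 1))"
    by (rule runs_For[where N = "idx s ''k''" and T = "\<lambda>_. 3" and
        I = "\<lambda>i A. A (''first'', 0, 0) =
          (if \<exists>l<i. arr s (''e'', l, 0) = arr s (''e'', idx s ''k'', 0) then 0 else 1)"])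
      (auto simp: frame_idx frame_arr less_Suc_eq)
qed simp

lemma runs_zero_prog:
  fixes s defines "P \<equiv> idx s ''p''"
  shows "runs diag D zero_prog s (3 + P * (7 + P * 6))
    (\<lambda>t. \<forall>a<P. \<forall>b<P. arr t (''Tre'', a, b) = 0 \<and> arr t (''Tim'', a, b) = 0)"
  unfolding zero_prog_def
proof (rule runs_For[where N = P and T = "\<lambda>_. 3 + P * 6" and
    I = "\<lambda>i A. \<forall>a<i. \<forall>b<P. A (''Tre'', a, b) = 0 \<and> A (''Tim'', a, b) = 0"], goal_cases)
  case (5 i u)
  note [simp] = frame_idx[OF 5(2)]
  show ?case
  proof (rule runs_For[where N = P and T = "\<lambda>_. 2" and
      I = "\<lambda>j A. \<forall>a b. (a < i \<and> b < P \<or> a = i \<and> b < j) \<longrightarrow>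
         A (''Tre'', a, b) = 0 \<and> A (''Tim'', a, b) = 0"], goal_cases)
    case (5 j w)
    then show ?case using \<open>idx u ''x'' = i\<close> by (auto simp: frame_idx[OF 5(2)] less_Suc_eq)
  qed (use 5 in \<open>auto simp: P_def less_Suc_eq\<close>)
qed (auto simp: P_def)

section \<open>Accumulation of a reduced component\<close>

definition Tval :: "(vname \<times> nat \<times> nat \<Rightarrow> real) \<Rightarrow> nat \<Rightarrow> nat \<Rightarrow> complex" where
  "Tval A a b = Complex (A (''Tre'', a, b)) (A (''Tim'', a, b))"

definition Uval :: "(vname \<times> nat \<times> nat \<Rightarrow> real) \<Rightarrow> nat \<Rightarrow> nat \<Rightarrow> complex" where
  "Uval A r l = Complex (A (''ure'', r, l)) (A (''uim'', r, l))"

definition addend :: "state \<Rightarrow> nat \<Rightarrow> nat \<Rightarrow> nat \<Rightarrow> nat \<Rightarrow> nat \<Rightarrow> complex" where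
  "addend s k l a b y =
     complex_of_real (arr s (''e'', k, 0)) *
       (Uval (arr s) (a * idx s ''w'' + y * idx s ''v'') l *
        cnj (Uval (arr s) (b * idx s ''w'' + y * idx s ''v'') l))"

lemma runs_add_prog:
  fixes s defines "P \<equiv> idx s ''p''" and "Q \<equiv> idx s ''q''"
  shows "runs diag D add_prog s (3 + P * (7 + P * (7 + Q * 40)))
    (\<lambda>t. \<forall>a<P. \<forall>b<P. Tval (arr t) a b =
       Tval (arr s) a b + (\<Sum>y<Q. addend s (idx s ''k'') (idx s ''l'') a b y))"
proof -
  let ?G = "\<lambda>a b m. \<Sum>y<m. addend s (idx s ''k'') (idx s ''l'') a b y"
  show ?thesis
    unfolding add_prog_def
  proof (rule runs_For[where N = P and T = "\<lambda>_. 3 + P * (7 + Q * 40)" and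
      I = "\<lambda>i A. \<forall>a<P. \<forall>b<P. Tval A a b =
        Tval (arr s) a b + (if a < i then ?G a b Q else 0)"], goal_cases)
    case (5 i u)
    note u = 5(2)
    show ?case
    proof (rule runs_For[where N = P and T = "\<lambda>_. 3 + Q * 40" and
        I = "\<lambda>j A. \<forall>a<P. \<forall>b<P. Tval A a b =
          Tval (arr s) a b + (if a < i \<or> a = i \<and> b < j then ?G a b Q else 0)"], goal_cases)
      case (5 j v)
      note v = 5(2)
      show ?case
      \<comment> \<open>Lexicographic invariant: the cells before (i, j) are complete, the cell (i,
        j) holds its first m addends, the later ones are untouched. Each of the two assignments
        costs 18, namely four row addresses at 3, five real operations and the store; hence
        36.\<close>
      proof (rule runs_For[where N = Q and T = "\<lambda>_. 36" and
          I = "\<lambda>m A. \<forall>a<P. \<forall>b<P. Tval A a b =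
            Tval (arr s) a b + (if a < i \<or> a = i \<and> b < j then ?G a b Q
              else if a = i \<and> b = j then ?G a b m else 0)"], goal_cases)
        case (5 m w)
        note w = 5(2)
        have idx: "idx w ''x'' = i" "idx w ''z'' = j" "idx w ''y'' = m"
          using \<open>idx u ''x'' = i\<close> \<open>idx v ''z'' = j\<close> \<open>idx w ''y'' = m\<close>
          by (simp_all add: frame_idx[OF w] frame_idx[OF v])
        have same: "idx w x = idx s x" if "x \<notin> {''x'', ''z'', ''y''}" for x
          using that by (simp add: frame_idx[OF w] frame_idx[OF v] frame_idx[OF u])
        have same_arr: "arr w (x, a, b) = arr s (x, a, b)" if "x \<notin> {''Tre'', ''Tim''}" for x a b
          using that by (simp add: frame_arr[OF w] frame_arr[OF v] frame_arr[OF u])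
        \<comment> \<open>The two assignments form one complex update of a single cell; the second
          does not read what the first has written.\<close>
        let ?w = "(arr w)((''Tre'', i, j) := Re (Tval (arr w) i j + addend s (idx s ''k'') (idx s ''l'') i j m),
            (''Tim'', i, j) := Im (Tval (arr w) i j + addend s (idx s ''k'') (idx s ''l'') i j m))"
        have "Tval ?w a b = Tval (arr w) a b +
            (if a = i \<and> b = j then addend s (idx s ''k'') (idx s ''l'') i j m else 0)" for a b
          by (auto simp: Tval_def complex_eq_iff)
        then have "\<forall>a<P. \<forall>b<P. Tval ?w a b =
            Tval (arr s) a b + (if a < i \<or> a = i \<and> b < j then ?G a b Q
              else if a = i \<and> b = j then ?G a b (Suc m) else 0)"
          using 5(4) by auto
        then show ?case
          by (simp add: idx same same_arr Tval_def addend_def Uval_def algebra_simps)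
      qed (use 5 in \<open>auto simp: P_def Q_def frame_idx[OF u] frame_idx[OF v] less_Suc_eq\<close>)
    qed (use 5 in \<open>auto simp: P_def Q_def frame_idx[OF u] less_Suc_eq\<close>)
  qed (auto simp: P_def)
qed

text \<open>The bound charges the expensive accumulation only to the columns with the eigenvalue of
  column k. Replacing it by its maximum over all columns would destroy the amortization over
  k.\<close>

lemma runs_gather_prog:
  fixes s defines "P \<equiv> idx s ''p''" and "Q \<equiv> idx s ''q''" and "N \<equiv> idx s ''n''"
    and "same \<equiv> \<lambda>l. arr s (''e'', l, 0) = arr s (''e'', idx s ''k'', 0)"
  assumes "arr s (''dim'', 0, 0) = 0" "\<And>a b. a < P \<Longrightarrow> b < P \<Longrightarrow> Tval (arr s) a b = 0"
  shows "runs diag D gather_prog s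
      (3 + (\<Sum>l<N. 6 + (if same l then 5 + P * (7 + P * (7 + Q * 40)) else 0)))
    (\<lambda>t. arr t (''dim'', 0, 0) = card {l. l < N \<and> same l} \<and>
       (\<forall>a<P. \<forall>b<P. Tval (arr t) a b =
         (\<Sum>l<N. if same l then (\<Sum>y<Q. addend s (idx s ''k'') l a b y) else 0)))"
  unfolding gather_prog_def
proof (rule runs_For[where N = N and
    T = "\<lambda>l. 2 + (if same l then 5 + P * (7 + P * (7 + Q * 40)) else 0)" and
    I = "\<lambda>m A. A (''dim'', 0, 0) = card {l. l < m \<and> same l} \<and>
       (\<forall>a<P. \<forall>b<P. Tval A a b =
         (\<Sum>l<m. if same l then (\<Sum>y<Q. addend s (idx s ''k'') l a b y) else 0))"], goal_cases)
  case (5 m u)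
  note u = 5(2)
  show ?case
  proof (cases "same m")
    case False
    then have "{l. l < Suc m \<and> same l} = {l. l < m \<and> same l}"
      by (auto simp: less_Suc_eq)
    then show ?thesis
      using False 5 by (auto simp: frame_idx[OF u] frame_arr[OF u] same_def)
  next
    case True
    then have "{l. l < Suc m \<and> same l} = insert m {l. l < m \<and> same l}"
      by (auto simp: less_Suc_eq)
    then have card: "card {l. l < Suc m \<and> same l} = Suc (card {l. l < m \<and> same l})"
      by simp
    define w where "w = u\<lparr>arr := (arr u)((''dim'', 0, 0) := arr u (''dim'', 0, 0) + 1)\<rparr>"
    have idx: "idx w ''p'' = P" "idx w ''q'' = Q" "idx w ''l'' = m" "idx w ''k'' = idx s ''k''"
      by (simp_all add: w_def frame_idx[OF u] P_def Q_def \<open>idx u ''l'' = m\<close>)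
    have addend: "addend w k m a b y = addend s k m a b y" for k a b y
      by (simp add: w_def addend_def Uval_def frame_idx[OF u] frame_arr[OF u])
    have Tval: "Tval (arr w) a b = Tval (arr u) a b" for a b
      by (simp add: w_def Tval_def)
    have dim: "arr w (''dim'', 0, 0) = card {l. l < Suc m \<and> same l}"
      using 5 card by (simp add: w_def)
    have "runs diag D add_prog w (3 + P * (7 + P * (7 + Q * 40)))
       (\<lambda>t. arr t (''dim'', 0, 0) = card {l. l < Suc m \<and> same l} \<and>
       (\<forall>a<P. \<forall>b<P. Tval (arr t) a b =
         (\<Sum>l<Suc m. if same l then (\<Sum>y<Q. addend s (idx s ''k'') l a b y) else 0)))"
      using runs_add_prog[of diag D w] unfolding idx addend Tval
      by (rule runs_weaken) (use 5 True in \<open>auto simp: frame_arr dim\<close>)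
    then show ?thesis
      using True unfolding w_def
      by (simp add: frame_idx[OF u] frame_arr[OF u] \<open>idx u ''l'' = m\<close> same_def)
  qed
qed (use assms in \<open>auto simp: add.commute add.left_commute cong: if_cong\<close>)

section \<open>Contribution of one eigenvalue\<close>

definition summand :: "real \<Rightarrow> real \<Rightarrow> real \<Rightarrow> real" where
  "summand \<eta> d l = \<bar>l - nim \<eta> l\<bar> * log 2 (l / (\<eta> * d))"

lemma runs_summand_prog:
  fixes s defines "\<eta> \<equiv> arr s (''e'', idx s ''k'', 0)" and "l \<equiv> arr s (''h'', idx s ''i'', 0)"
  shows "runs diag D summand_prog s 30
    (\<lambda>t. arr t (''acc'', 0, 0) =
       arr s (''acc'', 0, 0) - summand \<eta> (arr s (''dim'', 0, 0)) l)"
proof -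
  let ?lo = "\<eta> * of_int \<lfloor>l / \<eta>\<rfloor>" and ?hi = "\<eta> * of_int \<lceil>l / \<eta>\<rceil>"
  \<comment> \<open>For \<open>\<eta> = 0\<close> both multiples are 0, which agrees with \<open>nim 0 l = 0\<close>.\<close>
  have nim: "l - nim \<eta> l = (if ?hi - l < l - ?lo then l - ?hi else l - ?lo)"
    by (auto simp: nim_def)
  show ?thesis
    unfolding summand_prog_def Let_def
    by (simp add: summand_def nim flip: \<eta>_def l_def)
qed


lemma runs_sum_prog:
  fixes s defines "\<eta> \<equiv> arr s (''e'', idx s ''k'', 0)" and "P \<equiv> idx s ''p''"
  shows "runs diag D sum_prog s (3 + 36 * P)
    (\<lambda>t. arr t (''acc'', 0, 0) = arr s (''acc'', 0, 0) -
       (\<Sum>i<P. if arr s (''h'', i, 0) = 0 then 0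
              else summand \<eta> (arr s (''dim'', 0, 0)) (arr s (''h'', i, 0))))"
  unfolding sum_prog_def
proof (rule runs_For[where N = P and T = "\<lambda>_. 32" and
    I = "\<lambda>m A. A (''acc'', 0, 0) = arr s (''acc'', 0, 0) -
       (\<Sum>i<m. if arr s (''h'', i, 0) = 0 then 0
              else summand \<eta> (arr s (''dim'', 0, 0)) (arr s (''h'', i, 0)))"], goal_cases)
  case (5 m u)
  note u = 5(2)
  have "runs diag D summand_prog u 30
    (\<lambda>t. arr t (''acc'', 0, 0) =
       arr u (''acc'', 0, 0) - summand \<eta> (arr s (''dim'', 0, 0)) (arr s (''h'', m, 0)))"
    using runs_summand_prog[of diag D u] \<open>idx u ''i'' = m\<close>
    by (simp add: frame_idx[OF u] frame_arr[OF u] \<eta>_def)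
  with 5 show ?case
    by (simp add: frame_idx[OF u] frame_arr[OF u] diff_diff_eq)
qed (auto simp: P_def)

text \<open>The matrix that \<open>Tre\<close> and \<open>Tim\<close> are to hold, expressed by the
  state alone; its identification with a partial trace is a separate matter.\<close>

definition reduced_component :: "state \<Rightarrow> nat \<Rightarrow> complex mat" where
  "reduced_component s k = mat (idx s ''p'') (idx s ''p'') (\<lambda>(a, b).
     \<Sum>l<idx s ''n''. if arr s (''e'', l, 0) = arr s (''e'', k, 0)
       then (\<Sum>y<idx s ''q''. addend s k l a b y) else 0)"

definition multiplicity_in :: "state \<Rightarrow> nat \<Rightarrow> nat" where
  "multiplicity_in s k =
     card {l. l < idx s ''n'' \<and> arr s (''e'', l, 0) = arr s (''e'', k, 0)}"

definition component_sum :: "state \<Rightarrow> nat \<Rightarrow> real" where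
  "component_sum s k = (\<Sum>l \<in># nonzero_eigenvalues (reduced_component s k).
     summand (arr s (''e'', k, 0)) (real (multiplicity_in s k)) l)"

lemma cnj_addend: "cnj (addend s k l a b y) = addend s k l b a y"
  by (simp add: addend_def)

text \<open>The guarantee of \<open>diagonalizes\<close> covers Hermitian matrices only, so this is
  what licenses the second diagonalization.\<close>

lemma hermitian_reduced_component: "hermitian_mat (reduced_component s k)"
proof -
  have "reduced_component s k \<in> carrier_mat (idx s ''p'') (idx s ''p'')"
    by (simp add: reduced_component_def)
  from hermitian_mat_iff[OF this] show ?thesis
    by (auto simp: reduced_component_def cnj_addend intro!: sum.cong)
qed

text \<open>Replaces the multiset of roots by the list that the routine returns, whose order is
  irrelevant in a sum.\<close>

lemma sum_nonzero_eigenvalues: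
  assumes "diagonalization n A e U" "A \<in> carrier_mat n n"
  shows "(\<Sum>l \<in># nonzero_eigenvalues A. f l) = (\<Sum>i<n. if e i = 0 then 0 else f (e i))"
proof -
  have "(\<Sum>l \<in># image_mset e (filter_mset (\<lambda>i. e i \<noteq> 0) (mset xs)). f l) =
      (\<Sum>i\<leftarrow>xs. if e i = 0 then 0 else f (e i))" for xs
    by (induction xs) auto
  from this[of "[0..<n]"] show ?thesis
    unfolding diagonalization_nonzero_eigenvalues[OF assms]
    by (simp add: interv_sum_list_conv_sum_set_nat lessThan_atLeast0)
qed

text \<open>The 11 collects the setup costs 1 + 3 + 3 + 1 + 3 of the five commands of
  \<open>eigenvalue_prog\<close>; 43 = 7 + 36 comes from clearing the rows and from evaluating the
  summands.\<close>

definition eigenvalue_cost :: "(nat \<Rightarrow> nat) \<Rightarrow> state \<Rightarrow> nat \<Rightarrow> nat" where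
  "eigenvalue_cost D s k = (let P = idx s ''p''; Q = idx s ''q'' in
     11 + P * (43 + P * 6) + D P + (\<Sum>l<idx s ''n''. 6 +
      (if arr s (''e'', l, 0) = arr s (''e'', k, 0) then 5 + P * (7 + P * (7 + Q * 40)) else 0)))"

lemma runs_eigenvalue_prog:
  assumes "diagonalizes diag"
  shows "runs diag D eigenvalue_prog s (eigenvalue_cost D s (idx s ''k''))
    (\<lambda>t. arr t (''acc'', 0, 0) = arr s (''acc'', 0, 0) - component_sum s (idx s ''k''))"
proof -
  let ?k = "idx s ''k''" and ?P = "idx s ''p''" and ?Q = "idx s ''q''" and ?N = "idx s ''n''"
  let ?same = "\<lambda>l. arr s (''e'', l, 0) = arr s (''e'', ?k, 0)"
  let ?G = "\<Sum>l<?N. 6 + (if ?same l then 5 + ?P * (7 + ?P * (7 + ?Q * 40)) else 0)"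
  define s\<^sub>1 where "s\<^sub>1 = s\<lparr>arr := (arr s)((''dim'', 0, 0) := 0)\<rparr>"
  have "runs diag D (Seq zero_prog (Seq gather_prog
       (Seq (Diag (IVar ''p'') ''Tre'' ''Tim'' ''h'' ''vre'' ''vim'') sum_prog))) s\<^sub>1
     ((3 + ?P * (7 + ?P * 6)) + ((3 + ?G) + ((D ?P + 1) + (3 + 36 * ?P))))
     (\<lambda>t. arr t (''acc'', 0, 0) = arr s (''acc'', 0, 0) - component_sum s ?k)"
  proof (rule runs_Seq[where K\<^sub>2 = "(3 + ?G) + ((D ?P + 1) + (3 + 36 * ?P))",
      OF runs_zero_prog[of diag D s\<^sub>1]], goal_cases)
    case (1 u)
    have idx_u: "idx u x = idx s x" if "x \<notin> {''x'', ''z''}" for x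
      using frame_idx[OF 1(1)] that by (simp add: s\<^sub>1_def)
    have arr_u: "arr u (x, i, j) = arr s (x, i, j)" if "x \<notin> {''Tre'', ''Tim'', ''dim''}" for x i j
      using frame_arr[OF 1(1)] that by (simp add: s\<^sub>1_def)
    have addend_u: "addend u k l a b y = addend s k l a b y" for k l a b y
      by (simp add: addend_def Uval_def arr_u idx_u)
    have dim_u: "arr u (''dim'', 0, 0) = 0"
      using frame_arr[OF 1(1)] by (simp add: s\<^sub>1_def)
    have T_u: "Tval (arr u) a b = 0" if "a < idx u ''p''" "b < idx u ''p''" for a b
      using 1(2) that by (simp add: Tval_def idx_u s\<^sub>1_def complex_eq_iff)
    let ?R = "reduced_component s ?k"
    have R: "?R \<in> carrier_mat ?P ?P" by (simp add: reduced_component_def)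
    have "runs diag D gather_prog u (3 + ?G)
      (\<lambda>t. arr t (''dim'', 0, 0) = multiplicity_in s ?k \<and>
        (\<forall>a<?P. \<forall>b<?P. Tval (arr t) a b = ?R $$ (a, b)))"
      by (rule runs_weaken[OF runs_gather_prog[of u diag D]])
        (use dim_u T_u in \<open>auto simp: idx_u arr_u addend_u multiplicity_in_def
          reduced_component_def cong: if_cong\<close>)
    then show ?case
    proof (rule runs_Seq[where K\<^sub>2 = "(D ?P + 1) + (3 + 36 * ?P)"], goal_cases)
      case (1 v)
      have idx_v: "idx v x = idx s x" if "x \<notin> {''x'', ''z'', ''l'', ''y''}" for x
        using frame_idx[OF 1(1)] that by (simp add: idx_u)
      have arr_v: "arr v (x, i, j) = arr s (x, i, j)" if "x \<notin> {''Tre'', ''Tim'', ''dim''}" for x i j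
        using frame_arr[OF 1(1)] that by (simp add: arr_u)
      have dim_v: "arr v (''dim'', 0, 0) = multiplicity_in s ?k"
        using 1(2) by simp
      \<comment> \<open>Only the P x P corner of the two arrays is known. Entries outside it may be
        left over from the other reduction, but \<open>read_mat\<close> does not reach them.\<close>
      have read: "read_mat ?P ''Tre'' ''Tim'' v = ?R"
        using 1(2) R by (intro eq_matI) (auto simp: read_mat_def Tval_def)
      have diag: "runs diag D (Diag (IVar ''p'') ''Tre'' ''Tim'' ''h'' ''vre'' ''vim'') v (D ?P + 1)
        (\<lambda>w. \<exists>e U. diagonalization ?P ?R e U \<and> w = write_diag ?P ''h'' ''vre'' ''vim'' (e, U) v)"
        by (rule runs_Diag[where N = ?P, OF assms])
          (auto simp: idx_v read hermitian_reduced_component)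
      show ?case
      proof (rule runs_Seq[OF diag])
        fix w
        assume "\<exists>e U. diagonalization ?P ?R e U \<and> w = write_diag ?P ''h'' ''vre'' ''vim'' (e, U) v"
        then obtain e U where eU: "diagonalization ?P ?R e U"
          and w: "w = write_diag ?P ''h'' ''vre'' ''vim'' (e, U) v"
          by blast
        have "runs diag D sum_prog w (3 + 36 * ?P)
          (\<lambda>t. arr t (''acc'', 0, 0) = arr s (''acc'', 0, 0) -
            (\<Sum>i<?P. if e i = 0 then 0
                 else summand (arr s (''e'', ?k, 0)) (multiplicity_in s ?k) (e i)))"
          using runs_sum_prog[of diag D w]
          by (simp add: w write_diag_def idx_v arr_v dim_v cong: if_cong sum.cong_simp)
        then show "runs diag D sum_prog w (3 + 36 * ?P)
          (\<lambda>t. arr t (''acc'', 0, 0) = arr s (''acc'', 0, 0) - component_sum s ?k)"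
          unfolding component_sum_def sum_nonzero_eigenvalues[OF eU R] .
      qed simp
    qed (auto simp: idx_u arr_u)
  qed (auto simp: s\<^sub>1_def)
  then show ?thesis
    unfolding eigenvalue_prog_def runs_Seq_RSet s\<^sub>1_def
    by (auto simp: eigenvalue_cost_def Let_def algebra_simps elim!: runs_weaken)
qed

text \<open>Both quantities depend only on data that the loop over k never writes, so in every round
  they can be evaluated in the initial state.\<close>

lemma component_cong:
  assumes "\<And>x. x \<in> {''n'', ''p'', ''q'', ''w'', ''v''} \<Longrightarrow> idx u x = idx s x"
    and "\<And>x i j. x \<in> {''e'', ''ure'', ''uim''} \<Longrightarrow> arr u (x, i, j) = arr s (x, i, j)"
  shows "component_sum u k = component_sum s k"
    and "eigenvalue_cost D u k = eigenvalue_cost D s k"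
proof -
  have "addend u k = addend s k"
    by (intro ext) (simp add: addend_def Uval_def assms)
  then have "reduced_component u k = reduced_component s k"
    by (simp add: reduced_component_def assms cong: if_cong)
  then show "component_sum u k = component_sum s k"
    using assms by (simp add: component_sum_def multiplicity_in_def)
  show "eigenvalue_cost D u k = eigenvalue_cost D s k"
    using assms by (simp add: eigenvalue_cost_def)
qed

section \<open>Summation over the distinct eigenvalues\<close>

definition is_first :: "state \<Rightarrow> nat \<Rightarrow> bool" where
  "is_first s k \<longleftrightarrow> (\<forall>l<k. arr s (''e'', l, 0) \<noteq> arr s (''e'', k, 0))"

text \<open>The term 10 + 7 k consists of 4 + 7 k for the comparisons with earlier eigenvalues, 2
  for the test of the flag and 4 for the loop.\<close>

lemma runs_reduced_prog:
  assumes "diagonalizes diag"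
  shows "runs diag D reduced_prog s
      (3 + (\<Sum>k<idx s ''n''. 10 + 7 * k + (if is_first s k then eigenvalue_cost D s k else 0)))
    (\<lambda>t. arr t (''acc'', 0, 0) = arr s (''acc'', 0, 0) -
       (\<Sum>k<idx s ''n''. if is_first s k then component_sum s k else 0))"
  unfolding reduced_prog_def
proof (rule runs_For[where N = "idx s ''n''" and
    T = "\<lambda>k. 6 + 7 * k + (if is_first s k then eigenvalue_cost D s k else 0)" and
    I = "\<lambda>m A. A (''acc'', 0, 0) = arr s (''acc'', 0, 0) -
       (\<Sum>k<m. if is_first s k then component_sum s k else 0)"], goal_cases)
  case (5 k u)
  note u = 5(2)
  have "is_first u k = is_first s k"
    by (simp add: is_first_def frame_arr[OF u])
  then have first: "(\<exists>l<k. arr u (''e'', l, 0) = arr u (''e'', k, 0)) \<longleftrightarrow> \<not> is_first s k"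
    by (auto simp: is_first_def)
  show ?case
  proof (rule runs_Seq[OF runs_is_first_prog[of diag D u],
        where K\<^sub>2 = "2 + (if is_first s k then eigenvalue_cost D s k else 0)"], goal_cases)
    case (1 v)
    have "idx v ''k'' = k" "component_sum v k = component_sum s k"
      "eigenvalue_cost D v k = eigenvalue_cost D s k"
      using 5(3) by (auto simp: frame_idx[OF 1(1)] frame_arr[OF 1(1)]
          frame_idx[OF u] frame_arr[OF u] intro!: component_cong)
    moreover have "arr v (''acc'', 0, 0) = arr u (''acc'', 0, 0)"
      by (simp add: frame_arr[OF 1(1)])
    moreover have "arr v (''first'', 0, 0) = (if is_first s k then 1 else 0)"
      using 1(2) 5(3) first by simp
    ultimately show ?case
      using runs_eigenvalue_prog[OF assms, of D v] 5(4) by (simp add: diff_diff_eq)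
  next
    case 2
    show ?case using 5(3) by simp
  qed
qed (auto intro!: add_mono sum_mono)

section \<open>The polynomial cost bound\<close>

definition cost_bound :: "nat \<Rightarrow> nat \<Rightarrow> nat" where
  "cost_bound P Q = max (P ^ 3 * Q ^ 3) (max (P ^ 4 * Q) (P * Q ^ 4))"

text \<open>By this symmetry one estimate, applied with the roles of P and Q exchanged, covers both
  reductions.\<close>

lemma cost_bound_commute: "cost_bound P Q = cost_bound Q P"
  by (simp add: cost_bound_def ac_simps)

lemma monomial_le_cost_bound:
  assumes "1 \<le> P" "1 \<le> Q" "i \<le> 3 \<and> j \<le> 3 \<or> i \<le> 4 \<and> j \<le> 1"
  shows "P ^ i * Q ^ j \<le> cost_bound P Q"
proof -
  have "P ^ i * Q ^ j \<le> P ^ 3 * Q ^ 3 \<or> P ^ i * Q ^ j \<le> P ^ 4 * Q ^ 1"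
    using assms(3)
  proof
    assume "i \<le> 3 \<and> j \<le> 3"
    then have "P ^ i * Q ^ j \<le> P ^ 3 * Q ^ 3"
      using assms(1,2) by (intro mult_le_mono power_increasing) auto
    then show ?thesis ..
  next
    assume "i \<le> 4 \<and> j \<le> 1"
    then have "P ^ i * Q ^ j \<le> P ^ 4 * Q ^ 1"
      using assms(1,2) by (intro mult_le_mono power_increasing) auto
    then show ?thesis ..
  qed
  then show ?thesis by (auto simp: cost_bound_def)
qed

text \<open>Only one first index \<open>k\<close> carries the eigenvalue of a given column \<open>l\<close>, so all the
  accumulations of reduced projectors together cost no more than \<open>n\<close> single ones.\<close>

lemma sum_first_same_le:
  "(\<Sum>k<n. \<Sum>l<n. if is_first s k \<and> arr s (''e'', l, 0) = arr s (''e'', k, 0) then c else 0)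
    \<le> n * (c :: nat)"
    (is "(\<Sum>k<n. \<Sum>l<n. if ?P k l then c else 0) \<le> _")
proof -
  have "(\<Sum>k<n. if ?P k l then c else 0) \<le> c" for l
  proof -
    have "k = k'" if "?P k l" "?P k' l" for k k'
      using that by (cases k k' rule: linorder_cases) (auto simp: is_first_def)
    moreover have fin: "finite {k. k < n \<and> ?P k l}" by simp
    ultimately have "card {k. k < n \<and> ?P k l} \<le> 1"
      unfolding One_nat_def card_le_Suc0_iff_eq[OF fin] by blast
    moreover have "(\<Sum>k<n. if ?P k l then c else 0) = card {k. k < n \<and> ?P k l} * c"
      by (simp add: sum.If_cases Int_def)
    ultimately show ?thesis
      using mult_le_mono1[of "card {k. k < n \<and> ?P k l}" 1 c] by simp
  qed
  then have "(\<Sum>l<n. \<Sum>k<n. if ?P k l then c else 0) \<le> (\<Sum>l<n. c)"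
    by (intro sum_mono)
  also have "\<dots> = n * c" by simp
  finally show ?thesis
    by (subst sum.swap)
qed

text \<open>The proof yields 142 + c as the coefficient; the leading 3 is absorbed because the bound
  is at least 1, and 200 is a round number above 145.\<close>

lemma reduced_cost_le:
  assumes P: "P = idx s ''p''" "1 \<le> P" and Q: "Q = idx s ''q''" "1 \<le> Q"
    and N: "idx s ''n'' = P * Q" and D: "D P \<le> c * P ^ 3"
  shows "3 + (\<Sum>k<idx s ''n''. 10 + 7 * k + (if is_first s k then eigenvalue_cost D s k else 0))
    \<le> (200 + c) * cost_bound P Q"
proof -
  let ?N = "P * Q" and ?B = "cost_bound P Q"
  let ?same = "\<lambda>k l. arr s (''e'', l, 0) = arr s (''e'', k, 0)"
  let ?c = "5 + P * (7 + P * (7 + Q * 40))"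
  let ?d = "11 + P * (43 + P * 6) + D P + ?N * 6"
  have cost: "eigenvalue_cost D s k = ?d + (\<Sum>l<?N. if ?same k l then ?c else 0)" for k
    unfolding eigenvalue_cost_def Let_def N P(1)[symmetric] Q(1)[symmetric] sum.distrib by simp
  \<comment> \<open>Only the accumulation keeps the condition \<open>is_first s k\<close>; all other
    costs are charged to every k, which the bound can afford.\<close>
  have "10 + 7 * k + (if is_first s k then eigenvalue_cost D s k else 0) \<le>
      10 + 7 * ?N + ?d + (\<Sum>l<?N. if is_first s k \<and> ?same k l then ?c else 0)"
    if "k < ?N" for k
    using that unfolding cost by (cases "is_first s k") simp_all
  then have "(\<Sum>k<?N. 10 + 7 * k + (if is_first s k then eigenvalue_cost D s k else 0))
    \<le> (\<Sum>k<?N. 10 + 7 * ?N + ?d + (\<Sum>l<?N. if is_first s k \<and> ?same k l then ?c else 0))"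
    by (intro sum_mono) auto
  also have "\<dots> \<le> ?N * (10 + 7 * ?N + ?d) + ?N * ?c"
    unfolding sum.distrib[where g = "\<lambda>k. \<Sum>l<?N. _ k l"]
    using sum_first_same_le[where s = s and n = ?N and c = ?c] by simp
  also have "\<dots> \<le> ?N * (10 + 7 * ?N + (11 + P * (43 + P * 6) + c * P ^ 3 + ?N * 6)) + ?N * ?c"
    using D by simp
  \<comment> \<open>The monomial with P^4 comes from the small diagonalizations; every other one
    divides P^3 Q^3.\<close>
  also have "\<dots> = 26 * (P ^ 1 * Q ^ 1) + 13 * (P ^ 2 * Q ^ 2) + 50 * (P ^ 2 * Q ^ 1) +
      13 * (P ^ 3 * Q ^ 1) + c * (P ^ 4 * Q ^ 1) + 40 * (P ^ 3 * Q ^ 2)"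
    by (simp add: algebra_simps power2_eq_square power3_eq_cube power4_eq_xxxx)
  also have "\<dots> \<le> 26 * ?B + 13 * ?B + 50 * ?B + 13 * ?B + c * ?B + 40 * ?B"
    by (intro add_mono mult_le_mono monomial_le_cost_bound P(2) Q(2)) auto
  finally have "(\<Sum>k<?N. 10 + 7 * k + (if is_first s k then eigenvalue_cost D s k else 0))
    \<le> 142 * ?B + c * ?B" by simp
  moreover have "1 \<le> ?B"
    using monomial_le_cost_bound[OF P(2) Q(2), of 0 0] by simp
  ultimately show ?thesis
    unfolding N by (simp add: algebra_simps)
qed

text \<open>The finitely many values before the asymptotic estimate sets in are absorbed by adding
  their sum to the constant. This works for n at least 1, where the cube is at least 1.\<close>

lemma bigo_cube_bound:
  fixes D :: "nat \<Rightarrow> nat"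
  assumes "(\<lambda>n. real (D n)) \<in> O(\<lambda>n. real n ^ 3)"
  shows "\<exists>c. \<forall>n\<ge>1. D n \<le> c * n ^ 3"
proof -
  from landau_o.bigE[OF assms] obtain C
    where "eventually (\<lambda>n. norm (real (D n)) \<le> C * norm (real n ^ 3)) at_top"
    by blast
  then obtain n\<^sub>0 where n\<^sub>0: "norm (real (D n)) \<le> C * norm (real n ^ 3)" if "n \<ge> n\<^sub>0" for n
    unfolding eventually_at_top_linorder by blast
  let ?c = "nat \<lceil>C\<rceil> + (\<Sum>n<n\<^sub>0. D n)"
  have "D n \<le> ?c * n ^ 3" if "1 \<le> n" for n
  proof (cases "n \<ge> n\<^sub>0")
    case True
    have "real (D n) \<le> C * real n ^ 3" using n\<^sub>0[OF True] by simp
    also have "\<dots> \<le> real (nat \<lceil>C\<rceil>) * real n ^ 3"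
      by (intro mult_right_mono) (auto simp: real_nat_ceiling_ge)
    also have "\<dots> = real (nat \<lceil>C\<rceil> * n ^ 3)" by simp
    finally have "D n \<le> nat \<lceil>C\<rceil> * n ^ 3"
      unfolding of_nat_le_iff .
    then show ?thesis by (simp add: add_mult_distrib)
  next
    case False
    then have "D n \<le> (\<Sum>n<n\<^sub>0. D n)"
      by (intro member_le_sum) auto
    also have "\<dots> \<le> ?c * 1" by simp
    also have "\<dots> \<le> ?c * n ^ 3"
      using that by (intro mult_le_mono2) simp
    finally show ?thesis .
  qed
  then show ?thesis by (intro exI[of _ ?c] allI impI)
qed

section \<open>Agreement with the definition of the measure\<close>

definition kept_trace :: "nat \<Rightarrow> nat \<Rightarrow> nat \<Rightarrow> nat \<Rightarrow> complex mat \<Rightarrow> complex mat" where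
  "kept_trace P Q w v X = mat P P (\<lambda>(a, b). \<Sum>y<Q. X $$ (a * w + y * v, b * w + y * v))"

text \<open>Both partial traces are one sum with different strides, so that correctness is proved
  once for \<open>kept_trace\<close>.\<close>

lemma ptrace_B_eq: "ptrace_B dA dB = kept_trace dA dB dB 1"
  by (intro ext) (simp add: ptrace_B_def kept_trace_def)

lemma ptrace_A_eq: "ptrace_A dA dB = kept_trace dB dA 1 dB"
  by (intro ext) (simp add: ptrace_A_def kept_trace_def add.commute)

text \<open>The map e is a bijection from the first indices to the distinct eigenvalues, and under
  it the accumulated matrix becomes the partial trace of the eigencomponent and the count becomes
  the dimension of the eigenspace. \<open>bound\<close> keeps the row numbers inside the matrix
  U.\<close>

lemma sum_component_sum:
  assumes diag: "diagonalization n \<rho> e U" and \<rho>: "\<rho> \<in> carrier_mat n n"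
    and n: "idx s ''n'' = n"
    and ev: "\<And>l. l < n \<Longrightarrow> arr s (''e'', l, 0) = e l"
    and U: "\<And>r l. r < n \<Longrightarrow> l < n \<Longrightarrow> Uval (arr s) r l = U $$ (r, l)"
    and bound: "\<And>a y. a < idx s ''p'' \<Longrightarrow> y < idx s ''q'' \<Longrightarrow>
      a * idx s ''w'' + y * idx s ''v'' < n"
  shows "(\<Sum>k<n. if is_first s k then component_sum s k else 0) =
    - M_reduced (kept_trace (idx s ''p'') (idx s ''q'') (idx s ''w'') (idx s ''v'')) \<rho>"
proof -
  let ?red = "kept_trace (idx s ''p'') (idx s ''q'') (idx s ''w'') (idx s ''v'')"
  let ?f = "\<lambda>\<eta>. \<Sum>l \<in># nonzero_eigenvalues (?red (eigencomponent \<rho> \<eta>)).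
      \<bar>l - nim \<eta> l\<bar> * log 2 (l / (\<eta> * real (eigenspace_dim \<rho> \<eta>)))"
  let ?F = "{k. k < n \<and> is_first s k}"
  have component: "component_sum s k = ?f (e k)" if k: "k < n" for k
  proof -
    have "reduced_component s k = ?red (eigencomponent \<rho> (e k))"
    proof (rule eq_matI)
      fix a b assume "a < dim_row (?red (eigencomponent \<rho> (e k)))"
        "b < dim_col (?red (eigencomponent \<rho> (e k)))"
      then have ab: "a < idx s ''p''" "b < idx s ''p''" by (auto simp: kept_trace_def)
      let ?i = "\<lambda>a y. a * idx s ''w'' + y * idx s ''v''"
      have "reduced_component s k $$ (a, b) = (\<Sum>l<n. if e l = e k then
          (\<Sum>y<idx s ''q''. complex_of_real (e k) * (U $$ (?i a y, l) * cnj (U $$ (?i b y, l)))) else 0)"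
        using ab k by (auto simp: reduced_component_def n ev U bound addend_def intro!: sum.cong)
      \<comment> \<open>Linearity of the partial trace: the program reduces each column and then
        adds, the definition adds first.\<close>
      also have "\<dots> = (\<Sum>y<idx s ''q''. complex_of_real (e k) * (\<Sum>l<n. if e l = e k then
          U $$ (?i a y, l) * cnj (U $$ (?i b y, l)) else 0))"
        by (subst sum_distrib_left, subst sum.swap) (auto intro!: sum.cong)
      also have "\<dots> = ?red (eigencomponent \<rho> (e k)) $$ (a, b)"
        using ab \<rho> bound by (auto simp: kept_trace_def eigencomponent_def
            diagonalization_orth_projector[OF diag \<rho>] intro!: sum.cong)
      finally show "reduced_component s k $$ (a, b) = ?red (eigencomponent \<rho> (e k)) $$ (a, b)" .
    qed (auto simp: reduced_component_def kept_trace_def)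
    moreover have "multiplicity_in s k = eigenspace_dim \<rho> (e k)"
      unfolding diagonalization_eigenspace_dim[OF diag \<rho>] multiplicity_in_def n
      using k by (intro arg_cong[of _ _ card]) (auto simp: ev)
    ultimately show ?thesis
      using k by (simp add: component_sum_def summand_def ev)
  qed
  have inj: "inj_on e ?F"
  proof (rule inj_onI)
    fix k k' assume "k \<in> ?F" "k' \<in> ?F" "e k = e k'"
    then show "k = k'"
      by (cases k k' rule: linorder_cases) (auto simp: is_first_def ev)
  qed
  have image: "e ` ?F = {\<eta>. eigenvalue \<rho> (complex_of_real \<eta>)}"
  proof (intro subset_antisym subsetI)
    fix \<eta> assume "\<eta> \<in> {\<eta>. eigenvalue \<rho> (complex_of_real \<eta>)}"
    then have ex: "\<exists>k. k < n \<and> e k = \<eta>"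
      by (auto simp: diagonalization_eigenvalue[OF diag \<rho>])
    \<comment> \<open>The least index carrying \<eta> is a first index, which gives
      surjectivity.\<close>
    define k where "k = (LEAST k. k < n \<and> e k = \<eta>)"
    have k: "k < n \<and> e k = \<eta>" unfolding k_def using ex by (rule LeastI_ex)
    have "e l \<noteq> e k" if "l < k" for l
      using not_less_Least[OF that[unfolded k_def]] that k by auto
    then have "k \<in> ?F" using k by (auto simp: is_first_def ev)
    then show "\<eta> \<in> e ` ?F" using k by blast
  qed (auto simp: diagonalization_eigenvalue[OF diag \<rho>])
  have "(\<Sum>k<n. if is_first s k then component_sum s k else 0) = (\<Sum>k\<in>?F. ?f (e k))"
    by (auto simp: sum.If_cases Int_def component intro!: sum.cong)
  also have "\<dots> = (\<Sum>\<eta>\<in>e ` ?F. ?f \<eta>)"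
    by (simp add: sum.reindex[OF inj])
  finally show ?thesis
    unfolding image M_reduced_def by simp
qed

definition holds_diagonalization :: "state \<Rightarrow> nat \<Rightarrow> (nat \<Rightarrow> real) \<Rightarrow> complex mat \<Rightarrow> bool" where
  "holds_diagonalization s n e U \<longleftrightarrow> idx s ''n'' = n \<and>
     (\<forall>l<n. arr s (''e'', l, 0) = e l) \<and> (\<forall>r<n. \<forall>l<n. Uval (arr s) r l = U $$ (r, l))"

lemma runs_reduced_prog_M:
  assumes "diagonalizes diag" and cost: "D P \<le> c * P ^ 3"
    and diag: "diagonalization n \<rho> e U" "\<rho> \<in> carrier_mat n n" "holds_diagonalization s n e U"
    and n: "n = P * Q" "1 \<le> P" "1 \<le> Q"
    and idx: "idx s ''p'' = P" "idx s ''q'' = Q" "idx s ''w'' = w" "idx s ''v'' = v"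
    and bound: "\<And>a y. a < P \<Longrightarrow> y < Q \<Longrightarrow> a * w + y * v < n"
  shows "runs diag D reduced_prog s ((200 + c) * cost_bound P Q)
    (\<lambda>t. arr t (''acc'', 0, 0) = arr s (''acc'', 0, 0) + M_reduced (kept_trace P Q w v) \<rho>)"
proof (rule runs_weaken[OF runs_reduced_prog[OF assms(1), of D s]])
  have "idx s ''n'' = P * Q"
    using diag(3) n by (simp add: holds_diagonalization_def)
  then show "3 + (\<Sum>k<idx s ''n''. 10 + 7 * k + (if is_first s k then eigenvalue_cost D s k else 0))
    \<le> (200 + c) * cost_bound P Q"
    using idx n cost by (intro reduced_cost_le) auto
  fix t
  assume "arr t (''acc'', 0, 0) = arr s (''acc'', 0, 0) -
    (\<Sum>k<idx s ''n''. if is_first s k then component_sum s k else 0)"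
  moreover have "(\<Sum>k<n. if is_first s k then component_sum s k else 0) =
      - M_reduced (kept_trace P Q w v) \<rho>"
    using sum_component_sum[OF diag(1,2), of s] diag(3) bound
    by (simp add: idx holds_diagonalization_def)
  ultimately show "arr t (''acc'', 0, 0) =
      arr s (''acc'', 0, 0) + M_reduced (kept_trace P Q w v) \<rho>"
    using diag(3) by (simp add: holds_diagonalization_def)
qed

lemma mixed_radix_less: "a < m \<Longrightarrow> b < n \<Longrightarrow> a * n + b < m * (n :: nat)"
  by (metis add.commute add_less_cancel_left less_eq_Suc_le less_le_trans mult_Suc mult_le_mono1)

lemma mixed_radix_less': "a < n \<Longrightarrow> b < m \<Longrightarrow> a + b * n < m * (n :: nat)"
  using mixed_radix_less[of b m a n] by (simp add: add.commute)

lemma runs_measure_prog: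
  assumes diag: "diagonalizes diag" and D: "\<And>n. 1 \<le> n \<Longrightarrow> D n \<le> c * n ^ 3"
    and dim: "1 \<le> dA" "1 \<le> dB" and \<rho>: "density_matrix (dA * dB) \<rho>"
  shows "runs diag D measure_prog (input_state dA dB \<rho>) ((420 + 3 * c) * cost_bound dA dB)
    (\<lambda>t. result t = M_measure dA dB \<rho>)"
proof -
  let ?n = "dA * dB" and ?B = "cost_bound dA dB"
  define s where "s = (input_state dA dB \<rho>)\<lparr>idx := (idx (input_state dA dB \<rho>))(''n'' := ?n)\<rparr>"
  have idx_s: "idx s ''n'' = ?n" "idx s ''dA'' = dA" "idx s ''dB'' = dB"
    by (simp_all add: s_def input_state_def)
  have carrier: "\<rho> \<in> carrier_mat ?n ?n" and herm: "hermitian_mat \<rho>"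
    using \<rho> by (auto simp: density_matrix_def)
  have read: "read_mat ?n ''rho_re'' ''rho_im'' s = \<rho>"
    using carrier by (intro eq_matI) (auto simp: read_mat_def s_def input_state_def)
  let ?init = "\<lambda>u. \<exists>e U. diagonalization ?n \<rho> e U \<and> holds_diagonalization u ?n e U \<and>
    idx u ''dA'' = dA \<and> idx u ''dB'' = dB"
  have 1: "runs diag D (Diag (IVar ''n'') ''rho_re'' ''rho_im'' ''e'' ''ure'' ''uim'') s
      (D ?n + 1) ?init"
  proof (rule runs_Diag[where N = ?n, OF diag])
    fix e U t
    assume "diagonalization ?n (read_mat ?n ''rho_re'' ''rho_im'' s) e U"
      and t: "t = write_diag ?n ''e'' ''ure'' ''uim'' (e, U) s"
    then have "diagonalization ?n \<rho> e U" by (simp add: read)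
    moreover have "holds_diagonalization t ?n e U" "idx t ''dA'' = dA" "idx t ''dB'' = dB"
      by (simp_all add: t holds_diagonalization_def write_diag_def Uval_def idx_s)
    ultimately show "?init t" by blast
  qed (auto simp: idx_s read herm)
  have A: "runs diag D (params_prog (IVar ''dA'') (IVar ''dB'') (IVar ''dB'') (INum 1) reduced_prog) u
      (4 + (200 + c) * ?B)
      (\<lambda>t. arr t (''acc'', 0, 0) = arr u (''acc'', 0, 0) + M_A dA dB \<rho>)" if u: "?init u" for u
  proof -
    from u obtain e U where eU: "diagonalization ?n \<rho> e U" "holds_diagonalization u ?n e U"
      "idx u ''dA'' = dA" "idx u ''dB'' = dB" by blast
    define v where "v = u\<lparr>idx := (idx u)(''p'' := dA, ''q'' := dB, ''w'' := dB, ''v'' := 1)\<rparr>"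
    have "holds_diagonalization v ?n e U"
      using eU(2) by (simp add: holds_diagonalization_def v_def)
    then have "runs diag D reduced_prog v ((200 + c) * ?B)
      (\<lambda>t. arr t (''acc'', 0, 0) = arr v (''acc'', 0, 0) + M_A dA dB \<rho>)"
      unfolding M_A_def ptrace_B_eq using dim
      by (intro runs_reduced_prog_M[OF diag D eU(1) carrier])
        (auto simp: v_def mixed_radix_less)
    then show ?thesis
      by (simp add: params_prog_def eU v_def)
  qed
  have B: "runs diag D (params_prog (IVar ''dB'') (IVar ''dA'') (INum 1) (IVar ''dB'') reduced_prog) u
      (4 + (200 + c) * ?B)
      (\<lambda>t. arr t (''acc'', 0, 0) = arr u (''acc'', 0, 0) + M_B dA dB \<rho>)" if u: "?init u" for u
  proof -
    from u obtain e U where eU: "diagonalization ?n \<rho> e U" "holds_diagonalization u ?n e U"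
      "idx u ''dA'' = dA" "idx u ''dB'' = dB" by blast
    define v where "v = u\<lparr>idx := (idx u)(''p'' := dB, ''q'' := dA, ''w'' := 1, ''v'' := dB)\<rparr>"
    have "holds_diagonalization v ?n e U"
      using eU(2) by (simp add: holds_diagonalization_def v_def)
    then have "runs diag D reduced_prog v ((200 + c) * cost_bound dB dA)
      (\<lambda>t. arr t (''acc'', 0, 0) = arr v (''acc'', 0, 0) + M_B dA dB \<rho>)"
      unfolding M_B_def ptrace_A_eq using dim
      by (intro runs_reduced_prog_M[OF diag D eU(1) carrier])
        (auto simp: v_def mult.commute mixed_radix_less')
    then show ?thesis
      by (simp add: params_prog_def eU v_def cost_bound_commute)
  qed
  let ?rest\<^sub>2 = "Seq (params_prog (IVar ''dB'') (IVar ''dA'') (INum 1) (IVar ''dB'') reduced_prog)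
         (SetCell ''M'' (RDiv (Cell ''acc'') (RNum 2)))"
  let ?rest\<^sub>1 = "Seq (params_prog (IVar ''dA'') (IVar ''dB'') (IVar ''dB'') (INum 1) reduced_prog)
     ?rest\<^sub>2"
  let ?K\<^sub>2 = "(4 + (200 + c) * ?B) + 2" and ?K\<^sub>1 = "(4 + (200 + c) * ?B) + ((4 + (200 + c) * ?B) + 2)"
  have rest2: "runs diag D ?rest\<^sub>2 u ?K\<^sub>2 (\<lambda>t. result t = M_measure dA dB \<rho>)"
    if "?init u" "arr u (''acc'', 0, 0) = M_A dA dB \<rho>" for u
    by (rule runs_Seq[OF B[OF that(1)], where K\<^sub>2 = 2])
      (use that(2) in \<open>auto simp: result_def M_measure_def\<close>)
  have rest1: "runs diag D ?rest\<^sub>1 u ?K\<^sub>1 (\<lambda>t. result t = M_measure dA dB \<rho>)"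
    if u: "?init u" "arr u (''acc'', 0, 0) = 0" for u
  proof (rule runs_Seq[OF A[OF u(1)], where K\<^sub>2 = ?K\<^sub>2])
    fix t
    assume t: "frame (params_prog (IVar ''dA'') (IVar ''dB'') (IVar ''dB'') (INum 1) reduced_prog) u t"
      and acc: "arr t (''acc'', 0, 0) = arr u (''acc'', 0, 0) + M_A dA dB \<rho>"
    \<comment> \<open>The small diagonalizations write to \<open>h\<close>, \<open>vre\<close> and
      \<open>vim\<close>, so the eigenbasis of \<rho> survives the first reduction and serves the
      second.\<close>
    have "?init t"
      using u(1) by (simp add: holds_diagonalization_def Uval_def
          frame_idx[OF t] frame_arr[OF t] params_prog_def)
    then show "runs diag D ?rest\<^sub>2 t ?K\<^sub>2 (\<lambda>t. result t = M_measure dA dB \<rho>)"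
      using rest2 acc u(2) by simp
  qed simp
  define K where "K = ?K\<^sub>1"
  have "runs diag D
      (Seq (Diag (IVar ''n'') ''rho_re'' ''rho_im'' ''e'' ''ure'' ''uim'')
        (Seq (SetCell ''acc'' (RNum 0)) ?rest\<^sub>1)) s ((D ?n + 1) + (1 + K))
      (\<lambda>t. result t = M_measure dA dB \<rho>)"
  proof (rule runs_Seq[OF 1, where K\<^sub>2 = "1 + K"])
    fix u assume u: "?init u"
    let ?u = "u\<lparr>arr := (arr u)((''acc'', 0, 0) := 0)\<rparr>"
    have "?init ?u" using u by (simp add: holds_diagonalization_def Uval_def)
    then have "runs diag D ?rest\<^sub>1 ?u K (\<lambda>t. result t = M_measure dA dB \<rho>)"
      unfolding K_def by (rule rest1) simp
    then show "runs diag D (Seq (SetCell ''acc'' (RNum 0)) ?rest\<^sub>1) u (1 + K)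
        (\<lambda>t. result t = M_measure dA dB \<rho>)"
      unfolding runs_Seq_RSet by simp
  qed simp
  then have "runs diag D measure_prog (input_state dA dB \<rho>) (2 + ((D ?n + 1) + (1 + K)))
      (\<lambda>t. result t = M_measure dA dB \<rho>)"
    unfolding measure_prog_def runs_Seq_ISet by (simp add: s_def input_state_def)
  \<comment> \<open>Each reduction contributes 200 + c and the large diagonalization c; the
    remaining constants add up to 14, which the surplus 20 covers.\<close>
  moreover have "2 + ((D ?n + 1) + (1 + K)) \<le> (420 + 3 * c) * ?B"
  proof -
    have "D ?n \<le> c * ?n ^ 3" using D[of ?n] dim by simp
    also have "?n ^ 3 \<le> ?B" by (simp add: power_mult_distrib cost_bound_def)
    finally have "D ?n \<le> c * ?B" by simp
    moreover have "1 \<le> ?B"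
      using monomial_le_cost_bound[OF dim, of 0 0] by simp
    ultimately show ?thesis by (simp add: K_def algebra_simps)
  qed
  ultimately show ?thesis
    by (auto elim: runs_weaken)
qed

theorem mainTheorem9:
  shows "\<exists>P :: com. \<forall>(diag :: diagonalizer) (D :: nat \<Rightarrow> nat).
    diagonalizes diag \<longrightarrow> (\<lambda>n. real (D n)) \<in> O(\<lambda>n. real n ^ 3) \<longrightarrow>
    (\<exists>C :: real. \<forall>(dA :: nat) (dB :: nat) (\<rho> :: complex mat).
      1 \<le> dA \<longrightarrow> 1 \<le> dB \<longrightarrow> density_matrix (dA * dB) \<rho> \<longrightarrow>
      (\<exists>k t. exec diag D P (input_state dA dB \<rho>) k t \<and>
             result t = M_measure dA dB \<rho> \<and>
             real k \<le> C * real (max (dA ^ 3 * dB ^ 3) (max (dA ^ 4 * dB) (dA * dB ^ 4)))))"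
proof (intro exI[of _ measure_prog] allI impI)
  fix diag D
  assume diag: "diagonalizes diag" and D: "(\<lambda>n. real (D n)) \<in> O(\<lambda>n. real n ^ 3)"
  obtain c where c: "\<forall>n\<ge>1. D n \<le> c * n ^ 3"
    using bigo_cube_bound[OF D] ..
  show "\<exists>C :: real. \<forall>dA dB \<rho>. 1 \<le> dA \<longrightarrow> 1 \<le> dB \<longrightarrow> density_matrix (dA * dB) \<rho> \<longrightarrow>
      (\<exists>k t. exec diag D measure_prog (input_state dA dB \<rho>) k t \<and>
             result t = M_measure dA dB \<rho> \<and>
             real k \<le> C * real (max (dA ^ 3 * dB ^ 3) (max (dA ^ 4 * dB) (dA * dB ^ 4))))"
  \<comment> \<open>The number c was obtained from \<open>D\<close> alone, so the constant is
    uniform in the dimensions and in \<rho>.\<close>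
  proof (intro exI[of _ "real (420 + 3 * c)"] allI impI)
    fix dA dB \<rho>
    assume "1 \<le> dA" "1 \<le> dB" "density_matrix (dA * dB) \<rho>"
    from runs_measure_prog[OF diag c[rule_format] this] obtain k t
      where run: "exec diag D measure_prog (input_state dA dB \<rho>) k t"
        and k: "k \<le> (420 + 3 * c) * cost_bound dA dB" and result: "result t = M_measure dA dB \<rho>"
      unfolding runs_def by blast
    have "real k \<le> real (420 + 3 * c) * real (cost_bound dA dB)"
      unfolding of_nat_mult[symmetric] of_nat_le_iff by (rule k)
    with run result show "\<exists>k t. exec diag D measure_prog (input_state dA dB \<rho>) k t \<and>
             result t = M_measure dA dB \<rho> \<and>
             real k \<le> real (420 + 3 * c) *
               real (max (dA ^ 3 * dB ^ 3) (max (dA ^ 4 * dB) (dA * dB ^ 4)))"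
      unfolding cost_bound_def by blast
  qed
qed

end
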